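(* Let $\lambda$ be an infinite cardinal, $\theta$ an infinite regular cardinal and $\chi$ either $2$ or an infinite cardinal, and suppose $\chi\le\theta<\lambda$ and $\theta\neq\mathrm{cf}(\lambda)$. Then the following are equivalent: (1) $\{S\in I[\lambda^+]\mid S\subseteq E^{\lambda^+}_\theta\}\subseteq J_\chi[\lambda^+]$; (2) $J_\chi[\lambda^+]$ contains a stationary subset of $E^{\lambda^+}_\theta$; (3) $m(\theta,\lambda,\theta,\chi)=\lambda$; (4) $m(\lambda,\lambda,\theta,\chi)=\lambda$.
   Context: $E^\kappa_\theta=\{\alpha<\kappa\mid\mathrm{cf}(\alpha)=\theta\}$. For a set $\Delta$ with $|\Delta|\ge\theta$, $m(\Delta,\lambda,\theta,\chi)$ is the least size of a family $\mathcal H$ of functions from $\Delta$ to $[\lambda]^{<\chi}$ such that for every $X\in[\Delta]^\theta$ and every $g:X\to\lambda$ there is $h\in\mathcal H$ with $|\{\xi\in X\mid g(\xi)\in h(\xi)\}|=\theta$. For regular uncountable $\kappa$, $J_\chi[\kappa]$ is the collection of all $S\subseteq\kappa$ for which there exist a club $C\subseteq\kappa$ and functions $f_i:\kappa\to[\kappa]^{<\chi}$ ($i<\kappa$) such that for every $\alpha\in S\cap C$, every regressive $f:\alpha\to\alpha$ and every cofinal $B\subseteq\alpha$, there is $i<\alpha$ with $\sup\{\beta\in B\mid f(\beta)\in f_i(\beta)\}=\alpha$. $I[\kappa]$ is Shelah's approachability ideal: $S\in I[\kappa]$ iff there are a sequence $\langle a_\beta\mid\beta<\kappa\rangle$ of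 bounded subsets of $\kappa$ and a club $C\subseteq\kappa$ such that each $\alpha\in S\cap C$ has a cofinal $A\subseteq\alpha$ of order type $\mathrm{cf}(\alpha)$ with $\{A\cap\gamma\mid\gamma<\alpha\}\subseteq\{a_\beta\mid\beta<\alpha\}$. *)

theory Defs
  imports Main
begin

text \<open>Ordinals below kappa are modelled as the elements of the field of a
well-order R on a type 'a (with Field R = UNIV); R itself has order type kappa.
Cardinalities of sets are compared with the BNF cardinal library.\<close>

definition cle :: "'a set \<Rightarrow> 'b set \<Rightarrow> bool" where
  "cle A B \<longleftrightarrow> (card_of A, card_of B) \<in> ordLeq"

definition cless :: "'a set \<Rightarrow> 'b set \<Rightarrow> bool" where
  "cless A B \<longleftrightarrow> (card_of A, card_of B) \<in> ordLess"

definition ceq :: "'a set \<Rightarrow> 'b set \<Rightarrow> bool" where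
  "ceq A B \<longleftrightarrow> (card_of A, card_of B) \<in> ordIso"

definition olt :: "'a rel \<Rightarrow> 'a \<Rightarrow> 'a \<Rightarrow> bool" where
  "olt R a b \<longleftrightarrow> (a, b) \<in> R \<and> a \<noteq> b"

definition below :: "'a rel \<Rightarrow> 'a \<Rightarrow> 'a set" where
  "below R a = {b. olt R b a}"

definition cofinal_in :: "'a rel \<Rightarrow> 'a set \<Rightarrow> 'a \<Rightarrow> bool" where
  "cofinal_in R B \<alpha> \<longleftrightarrow> B \<subseteq> below R \<alpha> \<and> (\<forall>\<beta>\<in>below R \<alpha>. \<exists>b\<in>B. (\<beta>, b) \<in> R)"

text \<open>sup X = alpha (ordinal supremum = union), for X a subset of alpha.\<close>
definition sup_is :: "'a rel \<Rightarrow> 'a set \<Rightarrow> 'a \<Rightarrow> bool" where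
  "sup_is R X \<alpha> \<longleftrightarrow> X \<subseteq> below R \<alpha> \<and> (\<forall>\<beta>\<in>below R \<alpha>. \<exists>x\<in>X. olt R \<beta> x)"

definition is_cardinal :: "'a rel \<Rightarrow> 'a \<Rightarrow> bool" where
  "is_cardinal R t \<longleftrightarrow> (\<forall>\<beta>. olt R \<beta> t \<longrightarrow> cless (below R \<beta>) (below R t))"

definition cf_is :: "'a rel \<Rightarrow> 'a \<Rightarrow> 'a \<Rightarrow> bool" where
  "cf_is R \<alpha> t \<longleftrightarrow> is_cardinal R t \<and>
     (\<exists>B. cofinal_in R B \<alpha> \<and> ceq B (below R t)) \<and>
     (\<forall>B. cofinal_in R B \<alpha> \<longrightarrow> cle (below R t) B)"

definition E_cof :: "'a rel \<Rightarrow> 'a \<Rightarrow> 'a set" where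
  "E_cof R t = {\<alpha>. cf_is R \<alpha> t}"

definition is_limit :: "'a rel \<Rightarrow> 'a \<Rightarrow> bool" where
  "is_limit R \<alpha> \<longleftrightarrow> below R \<alpha> \<noteq> {} \<and> (\<forall>\<beta>\<in>below R \<alpha>. \<exists>\<gamma>\<in>below R \<alpha>. olt R \<beta> \<gamma>)"

definition club :: "'a rel \<Rightarrow> 'a set \<Rightarrow> bool" where
  "club R C \<longleftrightarrow> (\<forall>\<alpha>. \<exists>\<beta>\<in>C. olt R \<alpha> \<beta>) \<and>
     (\<forall>\<alpha>. is_limit R \<alpha> \<and> sup_is R (C \<inter> below R \<alpha>) \<alpha> \<longrightarrow> \<alpha> \<in> C)"

definition stationary :: "'a rel \<Rightarrow> 'a set \<Rightarrow> bool" where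
  "stationary R S \<longleftrightarrow> (\<forall>C. club R C \<longrightarrow> S \<inter> C \<noteq> {})"

definition regressive_on :: "'a rel \<Rightarrow> 'a \<Rightarrow> ('a \<Rightarrow> 'a) \<Rightarrow> bool" where
  "regressive_on R \<alpha> f \<longleftrightarrow>
     (\<forall>\<beta>\<in>below R \<alpha>. below R \<beta> \<noteq> {} \<longrightarrow> olt R (f \<beta>) \<beta>)"

definition J_ideal :: "'a rel \<Rightarrow> 'a \<Rightarrow> 'a set set" where
  "J_ideal R c = {S. \<exists>C F. club R C \<and>
      (\<forall>i \<beta>. cless (F i \<beta>) (below R c)) \<and>
      (\<forall>\<alpha>\<in>S \<inter> C. \<forall>f B. regressive_on R \<alpha> f \<and> cofinal_in R B \<alpha> \<longrightarrow>
          (\<exists>i\<in>below R \<alpha>. sup_is R {\<beta>\<in>B. f \<beta> \<in> F i \<beta>} \<alpha>))}"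

definition I_ideal :: "'a rel \<Rightarrow> 'a set set" where
  "I_ideal R = {S. \<exists>a C. (\<forall>\<beta>. \<exists>\<gamma>. a \<beta> \<subseteq> below R \<gamma>) \<and> club R C \<and>
      (\<forall>\<alpha>\<in>S \<inter> C. \<exists>A. cofinal_in R A \<alpha> \<and>
          (\<exists>t. cf_is R \<alpha> t \<and> (Restr R A, Restr R (below R t)) \<in> ordIso) \<and>
          (\<forall>\<gamma>\<in>below R \<alpha>. \<exists>\<beta>\<in>below R \<alpha>. A \<inter> below R \<gamma> = a \<beta>))}"

text \<open>m(Delta, L, theta, chi) has cardinality |K|, where Delta and L are sets of
ordinals, theta = |below t| and chi = |below c|. Functions Delta -> [L]^{<chi}
are represented as maps 'a => 'a set that vanish outside Delta.\<close>
definition good_family :: "'a rel \<Rightarrow> 'a set \<Rightarrow> 'a set \<Rightarrow> 'a \<Rightarrow> 'a \<Rightarrow> ('a \<Rightarrow> 'a set) set \<Rightarrow> bool" where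
  "good_family R \<Delta> L t c H \<longleftrightarrow>
     (\<forall>h\<in>H. (\<forall>\<xi>. \<xi> \<notin> \<Delta> \<longrightarrow> h \<xi> = {}) \<and>
             (\<forall>\<xi>\<in>\<Delta>. h \<xi> \<subseteq> L \<and> cless (h \<xi>) (below R c))) \<and>
     (\<forall>X g. X \<subseteq> \<Delta> \<and> ceq X (below R t) \<and> (\<forall>\<xi>\<in>X. g \<xi> \<in> L) \<longrightarrow>
        (\<exists>h\<in>H. ceq {\<xi>\<in>X. g \<xi> \<in> h \<xi>} (below R t)))"

definition m_is :: "'a rel \<Rightarrow> 'a set \<Rightarrow> 'a set \<Rightarrow> 'a \<Rightarrow> 'a \<Rightarrow> 'a set \<Rightarrow> bool" where
  "m_is R \<Delta> L t c K \<longleftrightarrow>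
     (\<exists>H. good_family R \<Delta> L t c H \<and> ceq H K) \<and>
     (\<forall>H. good_family R \<Delta> L t c H \<longrightarrow> cle K H)"

end

theory Submission
  imports Defs
begin

text \<open>
  The four statements are proved in the cycle (1), (2), (3), (4), (1), where $\theta$ is \<open>t\<close>,
  $\lambda$ is \<open>l\<close> and $\chi$ is \<open>c\<close>.

  (1) implies (2) because, by a theorem of Shelah, $I[\lambda^+]$ contains a stationary subset of
  $E^{\lambda^+}_\theta$.  If $\lambda=\theta^+$, such a set comes from injections $e_\beta:\beta\to\lambda$:
  below a point of cofinality $\theta$ there is a cofinal set $N$ of size $\theta$ all of whose initial
  segments are coded by two ordinals, and the rank function that the $e_\beta$ induce transports a fixed cofinal
  $\theta$-sequence of an ordinal below $\lambda$ to $N$.  Otherwise $\sigma=\theta^{++}\le\lambda$, and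
  one guesses clubs of $\sigma$ at points of cofinality $\theta$ and transports the guesses to points of
  cofinality $\sigma$.

  (2) implies (3): a single point of the stationary set above $\lambda$ suffices, because a function into
  $\lambda$ is regressive there.  (3) implies (4): since $\theta\ne\mathrm{cf}(\lambda)$, every
  $X\in[\lambda]^\theta$ has $\theta$ many elements below some $\delta<\lambda$, and after minimising
  $\delta$ a function $\delta\to\theta$ with bounded fibres takes $\theta$ many values on $X$.

  (4) implies (1): the ranks along relations built from the $e_\beta$ and a witness for $S\in I[\lambda^+]$
  give $\lambda$ many functions $\lambda^+\to\lambda$, one of which takes $\theta$ many values on any given
  cofinal subset of an approachable point.  Composing these with a family as in (4) gives the functions that
  witness $S\in J_\chi[\lambda^+]$.
\<close>

section \<open>Comparing cardinalities\<close>

text \<open>The hypothesis \<theta> \<noteq> cf(\<lambda>) acts through one principle,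
  \<open>small_target\<close>: if \<theta> many objects receive codes below \<lambda>, then \<theta>
  many of the codes lie below a single i < \<lambda>. So i can be guessed together with a member of
  a family of size \<lambda>. In (4) to (1) the injections e_b change with b and give no common
  domain; for each i the rank is one function from \<lambda>^+ to \<lambda>, and it increases along
  what is coded below i. The hypothesis \<chi> \<le> \<theta> < \<lambda> makes sets of size less
  than \<chi> too small for fewer than \<lambda> of them to cover \<lambda>. Hence m is at least
  \<lambda>, and (3) and (4) only ask for families of size at most \<lambda>. The case distinction
  in (1) to (2) comes from club guessing: clubs of \<sigma> are shrunk \<theta>^+ times, so \<sigma>
  has to exceed \<theta>^+, while only \<lambda> many guesses can be handled at each step below
  \<lambda>^+. For \<lambda> = \<theta>^+ the next \<sigma> would be \<lambda>^+ itself, but there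
  \<lambda> is regular, which permits closing off sets of size \<theta>.\<close>

lemma cle_iff: "cle A B \<longleftrightarrow> (\<exists>f. inj_on f A \<and> f ` A \<subseteq> B)"
  unfolding cle_def card_of_ordLeq[symmetric] ..

lemma cleI: "inj_on f A \<Longrightarrow> (\<And>x. x \<in> A \<Longrightarrow> f x \<in> B) \<Longrightarrow> cle A B"
  unfolding cle_iff by blast

lemma cle_refl [simp]: "cle A A"
  by (rule cleI[of id]) auto

lemma cle_subset: "A \<subseteq> B \<Longrightarrow> cle A B"
  by (rule cleI[of id]) auto

lemma cle_trans: "cle A B \<Longrightarrow> cle B C \<Longrightarrow> cle A C"
  unfolding cle_def by (rule ordLeq_transitive)

lemma cless_iff: "cless A B \<longleftrightarrow> \<not> cle B A"
  unfolding cless_def cle_def not_ordLeq_iff_ordLess[OF card_of_Well_order card_of_Well_order] ..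

lemma ceq_iff: "ceq A B \<longleftrightarrow> cle A B \<and> cle B A"
  unfolding ceq_def cle_def by (rule ordIso_iff_ordLeq)

lemma cle_total: "cle A B \<or> cle B A"
  unfolding cle_def by (rule ordLeq_total[OF card_of_Well_order card_of_Well_order])

lemma cle_image: "cle (f ` A) A"
  unfolding cle_def by (rule card_of_image)

lemma cle_image_le: "cle A B \<Longrightarrow> cle (f ` A) B"
  using cle_image cle_trans by blast

lemma cle_surj: "A \<subseteq> f ` B \<Longrightarrow> cle A B"
  by (blast intro: cle_trans cle_subset cle_image)

lemma cle_finite: "finite A \<Longrightarrow> infinite B \<Longrightarrow> cle A B"
  unfolding cle_def by (meson card_of_ordLeq_finite cle_def cle_total)

lemma cle_infinite: "cle A B \<Longrightarrow> infinite A \<Longrightarrow> infinite B"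
  unfolding cle_def by (rule card_of_ordLeq_infinite)

lemma cle_UN: "infinite B \<Longrightarrow> cle I B \<Longrightarrow> (\<And>i. i \<in> I \<Longrightarrow> cle (A i) B) \<Longrightarrow> cle (\<Union>i\<in>I. A i) B"
  unfolding cle_def by (rule card_of_UNION_ordLeq_infinite) auto

lemma cle_Un: "infinite B \<Longrightarrow> cle A B \<Longrightarrow> cle C B \<Longrightarrow> cle (A \<union> C) B"
  unfolding cle_def
  by (rule card_of_Un_ordLeq_infinite_Field) (simp_all only: Field_card_of card_of_card_order_on not_False_eq_True)

lemma cle_insert: "infinite B \<Longrightarrow> cle A B \<Longrightarrow> cle (insert x A) B"
  using cle_Un[of B "{x}" A] cle_finite[of "{x}" B] by simp

lemma cle_Times: "infinite B \<Longrightarrow> cle A B \<Longrightarrow> cle C B \<Longrightarrow> cle (A \<times> C) B"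
  unfolding cle_def
  by (rule card_of_Times_ordLeq_infinite_Field) (simp_all only: Field_card_of card_of_card_order_on not_False_eq_True)

lemma cle_inv: "cle A B \<Longrightarrow> A \<noteq> {} \<Longrightarrow> \<exists>f. f ` B = A"
  unfolding cle_def by (simp add: card_of_ordLeq2)

lemma cle_nat: "infinite B \<Longrightarrow> cle (UNIV :: nat set) B"
  unfolding cle_def by (simp add: infinite_iff_card_of_nat)

lemma cle_inj_image: "inj_on f A \<Longrightarrow> cle A (f ` A)"
  by (rule cleI) auto

lemma exists_section: "\<exists>Z\<subseteq>Y. inj_on f Z \<and> f ` Z = f ` Y"
  by (metis order_refl subset_image_inj)

section \<open>Clubs and cofinalities in a well-order\<close>

locale wo_base =
  fixes R :: "'a rel"
  assumes wo: "Well_order R" and fld: "Field R = UNIV"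
begin

abbreviation lte (infix "\<preceq>" 50) where "x \<preceq> y \<equiv> (x, y) \<in> R"
abbreviation lt (infix "\<prec>" 50) where "x \<prec> y \<equiv> olt R x y"
abbreviation seg where "seg \<equiv> below R"

sublocale ord: wellorder "\<lambda>x y. (x, y) \<in> R" "olt R"
proof -
  have lin: "Linear_order R" and wf: "wf (R - Id)"
    using wo by (auto simp: well_order_on_def)
  have refl: "\<And>x. (x, x) \<in> R" and tr: "\<And>x y z. (x,y) \<in> R \<Longrightarrow> (y,z) \<in> R \<Longrightarrow> (x,z) \<in> R"
    and anti: "\<And>x y. (x,y) \<in> R \<Longrightarrow> (y,x) \<in> R \<Longrightarrow> x = y"
    and tot: "\<And>x y. (x,y) \<in> R \<or> (y,x) \<in> R"
    using lin fld unfolding order_on_defs refl_on_def trans_def antisym_def total_on_def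
    by (auto, metis)
  show "class.wellorder (\<lambda>x y. (x, y) \<in> R) (olt R)"
  proof
    fix P a assume step: "\<And>x. (\<And>y. olt R y x \<Longrightarrow> P y) \<Longrightarrow> P x"
    show "P a"
      using wf
    proof (induction a rule: wf_induct_rule)
      case (less x)
      show ?case by (rule step) (use less in \<open>auto simp: olt_def\<close>)
    qed
  qed (use refl tr anti tot in \<open>auto simp: olt_def\<close>)
qed

lemma wf_lt: "wf {(x, y). x \<prec> y}"
  by (rule ord.wf)

lemma seg_iff [simp]: "x \<in> seg y \<longleftrightarrow> x \<prec> y"
  by (simp add: below_def)

text \<open>If \<open>P\<close> holds nowhere the value is arbitrary. This may happen for the index
  of a set that is never listed, where any value will do.\<close>

definition least :: "('a \<Rightarrow> bool) \<Rightarrow> 'a" where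
  "least P = (SOME x. P x \<and> (\<forall>y. P y \<longrightarrow> x \<preceq> y))"

lemma least_ex: "P x \<Longrightarrow> \<exists>x. P x \<and> (\<forall>y. P y \<longrightarrow> x \<preceq> y)"
  by (metis ord.LeastI ord.Least_le)

lemma leastI: "P x \<Longrightarrow> P (least P)"
  unfolding least_def using someI_ex[OF least_ex[of P]] by blast

lemma least_le: "P x \<Longrightarrow> least P \<preceq> x"
  unfolding least_def using someI_ex[OF least_ex[of P]] by blast

lemma not_less_least: "x \<prec> least P \<Longrightarrow> \<not> P x"
  using least_le ord.leD by blast

lemma wf_recursion:
  assumes "\<And>f g x. (\<And>y. y \<prec> x \<Longrightarrow> f y = g y) \<Longrightarrow> P f x = P g x"
  shows "\<exists>f. \<forall>x. f x = P f x"
proof -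
  have "adm_wf {(x, y). x \<prec> y} P"
    unfolding adm_wf_def using assms by blast
  then show ?thesis
    using wfrec_fixpoint[OF wf_lt] by metis
qed

lemma cofinalI: "(\<And>b. b \<in> B \<Longrightarrow> b \<prec> \<alpha>) \<Longrightarrow> (\<And>\<beta>. \<beta> \<prec> \<alpha> \<Longrightarrow> \<exists>b\<in>B. \<beta> \<preceq> b) \<Longrightarrow> cofinal_in R B \<alpha>"
  unfolding cofinal_in_def by (simp add: subset_iff)

lemma cofinal_below: "cofinal_in R B \<alpha> \<Longrightarrow> b \<in> B \<Longrightarrow> b \<prec> \<alpha>"
  unfolding cofinal_in_def by (simp add: subset_iff)

lemma cofinalD: "cofinal_in R B \<alpha> \<Longrightarrow> \<beta> \<prec> \<alpha> \<Longrightarrow> \<exists>b\<in>B. \<beta> \<preceq> b"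
  unfolding cofinal_in_def by simp

lemma limitD: "is_limit R \<alpha> \<Longrightarrow> \<beta> \<prec> \<alpha> \<Longrightarrow> \<exists>\<gamma>. \<beta> \<prec> \<gamma> \<and> \<gamma> \<prec> \<alpha>"
  unfolding is_limit_def by (metis seg_iff)

lemma limit_nonempty: "is_limit R \<alpha> \<Longrightarrow> \<exists>\<beta>. \<beta> \<prec> \<alpha>"
  unfolding is_limit_def by (metis ex_in_conv seg_iff)

lemma seg_mono: "x \<preceq> y \<Longrightarrow> seg x \<subseteq> seg y"
  by (auto intro: ord.less_le_trans)

section \<open>Successor cardinals as initial segments, and their clubs\<close>

text \<open>\<open>U\<close> is the cardinal successor of \<open>seg p\<close>. It is a set and not
  an ordinal because \<lambda>^+, which is the whole type, has to be covered as well as \<theta>^+,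
  \<theta>^{++} and, in one case, \<lambda>.\<close>

definition succ_seg :: "'a set \<Rightarrow> 'a \<Rightarrow> bool" where
  "succ_seg U p \<longleftrightarrow> infinite (seg p) \<and> (\<forall>x\<in>U. seg x \<subseteq> U \<and> cle (seg x) (seg p)) \<and> \<not> cle U (seg p)"

text \<open>Regularity of successor cardinals: an unbounded \<open>X\<close> would exhibit
  \<open>U\<close> as a union of at most |p| sets of size at most |p|.\<close>

lemma succ_seg_bounded:
  assumes U: "succ_seg U p" and X: "X \<subseteq> U" "cle X (seg p)"
  shows "\<exists>y\<in>U. \<forall>x\<in>X. x \<prec> y"
proof (rule ccontr)
  assume *: "\<not> ?thesis"
  have "U \<subseteq> (\<Union>x\<in>X. insert x (seg x))"
    using * by (fastforce simp: ord.not_less ord.le_less)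
  moreover have "cle (\<Union>x\<in>X. insert x (seg x)) (seg p)"
  proof (rule cle_UN)
    fix x assume "x \<in> X"
    then have "cle (seg x) (seg p)" "infinite (seg p)"
      using U X unfolding succ_seg_def by auto
    then show "cle (insert x (seg x)) (seg p)"
      by (simp add: cle_insert)
  qed (use U X in \<open>auto simp: succ_seg_def\<close>)
  ultimately show False
    using U cle_subset cle_trans unfolding succ_seg_def by blast
qed

lemma omega_sup:
  assumes U: "succ_seg U p" and s: "\<And>n::nat. s n \<in> U" and inc: "\<And>n. s n \<prec> s (Suc n)"
  shows "\<exists>\<alpha>\<in>U. (\<forall>n. s n \<prec> \<alpha>) \<and> (\<forall>y. y \<prec> \<alpha> \<longrightarrow> (\<exists>n. y \<prec> s n))"
proof -
  have "cle (range s) (seg p)"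
    using cle_image cle_nat U cle_trans unfolding succ_seg_def by blast
  then obtain b where b: "b \<in> U" "\<forall>n. s n \<prec> b"
    using succ_seg_bounded[OF U, of "range s"] s by blast
  define \<alpha> where "\<alpha> = least (\<lambda>b. \<forall>n. s n \<prec> b)"
  have 1: "\<forall>n. s n \<prec> \<alpha>"
    unfolding \<alpha>_def by (rule leastI[of _ b]) (use b in blast)
  have "\<alpha> \<preceq> b"
    unfolding \<alpha>_def by (rule least_le) (use b in blast)
  then have 2: "\<alpha> \<in> U"
    using b U ord.le_less unfolding succ_seg_def by fastforce
  have 3: "\<exists>n. y \<prec> s n" if "y \<prec> \<alpha>" for y
  proof -
    have "\<not> (\<forall>n. s n \<prec> y)"
      using that unfolding \<alpha>_def by (rule not_less_least)
    then obtain n where "y \<preceq> s n"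
      by (auto simp: ord.not_less)
    then show ?thesis
      using inc ord.le_less_trans by blast
  qed
  show ?thesis
    using 1 2 3 by blast
qed

text \<open>The strict inequalities make \<alpha> a limit ordinal; nonemptiness of
  \<open>seg \<alpha>\<close> excludes the least ordinal, which would qualify vacuously.\<close>

definition lp :: "'a set \<Rightarrow> 'a \<Rightarrow> bool" where
  "lp E \<alpha> \<longleftrightarrow> seg \<alpha> \<noteq> {} \<and> (\<forall>y. y \<prec> \<alpha> \<longrightarrow> (\<exists>e\<in>E. y \<prec> e \<and> e \<prec> \<alpha>))"

definition club_in :: "'a set \<Rightarrow> 'a set \<Rightarrow> bool" where
  "club_in U E \<longleftrightarrow> E \<subseteq> U \<and> (\<forall>x\<in>U. \<exists>y\<in>E. x \<prec> y) \<and> (\<forall>\<alpha>\<in>U. lp E \<alpha> \<longrightarrow> \<alpha> \<in> E)"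

lemma lp_mono: "lp E \<alpha> \<Longrightarrow> E \<subseteq> E' \<Longrightarrow> lp E' \<alpha>"
  unfolding lp_def by blast

lemma club_UNIV: "club R C \<longleftrightarrow> club_in UNIV C"
proof -
  have "is_limit R \<alpha> \<and> sup_is R (C \<inter> seg \<alpha>) \<alpha> \<longleftrightarrow> lp C \<alpha>" for \<alpha>
    unfolding is_limit_def sup_is_def lp_def Ball_def Bex_def Int_iff seg_iff by blast
  then show ?thesis
    unfolding club_def club_in_def by simp
qed

text \<open>Each term of the sequence \<open>s\<close> lies above chosen elements of all the
  \<open>E i\<close> beyond the previous term, which regularity permits. Its supremum is then a
  limit point of all \<open>E i\<close> at once.\<close>

lemma club_in_INT:
  assumes U: "succ_seg U p" and I: "cle I (seg p)" and E: "\<And>i. i \<in> I \<Longrightarrow> club_in U (E i)"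
  shows "club_in U {x\<in>U. \<forall>i\<in>I. x \<in> E i}" (is "club_in U ?E")
  unfolding club_in_def
proof (intro conjI ballI impI)
  fix \<alpha> assume \<alpha>: "\<alpha> \<in> U" "lp ?E \<alpha>"
  then have "lp (E i) \<alpha>" if "i \<in> I" for i
    using lp_mono[of ?E \<alpha> "E i"] that by blast
  then show "\<alpha> \<in> ?E"
    using E \<alpha> unfolding club_in_def by auto
next
  fix x assume x: "x \<in> U"
  have "\<forall>i\<in>I. \<forall>y\<in>U. \<exists>z. z \<in> E i \<and> y \<prec> z"
    using E unfolding club_in_def by blast
  then obtain nx where nx: "\<And>i y. i \<in> I \<Longrightarrow> y \<in> U \<Longrightarrow> nx i y \<in> E i \<and> y \<prec> nx i y"
    by metis
  have step: "\<exists>z\<in>U. y \<prec> z \<and> (\<forall>i\<in>I. nx i y \<prec> z)" if y: "y \<in> U" for y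
  proof -
    have "cle (insert y ((\<lambda>i. nx i y) ` I)) (seg p)"
      by (intro cle_insert cle_image_le I) (use U in \<open>simp add: succ_seg_def\<close>)
    moreover have "insert y ((\<lambda>i. nx i y) ` I) \<subseteq> U"
      using y nx E unfolding club_in_def by blast
    ultimately show ?thesis
      using succ_seg_bounded[OF U, of "insert y ((\<lambda>i. nx i y) ` I)"] by blast
  qed
  have "\<exists>s. \<forall>n. (s n \<in> U \<and> (n = 0 \<longrightarrow> s n = x)) \<and> (s n \<prec> s (Suc n) \<and> (\<forall>i\<in>I. nx i (s n) \<prec> s (Suc n)))"
    by (rule dependent_nat_choice) (use x step in auto)
  then obtain s :: "nat \<Rightarrow> 'a" where s: "s 0 = x" "\<And>n. s n \<in> U"
      "\<And>n. s n \<prec> s (Suc n) \<and> (\<forall>i\<in>I. nx i (s n) \<prec> s (Suc n))"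
    by blast
  obtain \<alpha> where \<alpha>: "\<alpha> \<in> U" "\<And>n. s n \<prec> \<alpha>" "\<And>y. y \<prec> \<alpha> \<Longrightarrow> \<exists>n. y \<prec> s n"
    using omega_sup[OF U, of s] s by blast
  have "lp (E i) \<alpha>" if i: "i \<in> I" for i
    unfolding lp_def
  proof (intro conjI allI impI)
    show "seg \<alpha> \<noteq> {}"
      using \<alpha>(2) seg_iff by blast
    fix y assume "y \<prec> \<alpha>"
    then obtain n where "y \<prec> s n"
      using \<alpha>(3) by blast
    then have "y \<prec> nx i (s n)" "nx i (s n) \<prec> \<alpha>" "nx i (s n) \<in> E i"
      using nx[OF i s(2), of n] s(3)[of n] i \<alpha>(2) ord.less_trans by blast+
    then show "\<exists>e\<in>E i. y \<prec> e \<and> e \<prec> \<alpha>"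
      by blast
  qed
  then have "\<alpha> \<in> ?E"
    using E \<alpha>(1) unfolding club_in_def by blast
  moreover have "x \<prec> \<alpha>"
    using \<alpha>(2)[of 0] s(1) by simp
  ultimately show "\<exists>y\<in>?E. x \<prec> y"
    by blast
qed auto

text \<open>The least admissible value is taken at every step; as each condition refers to a strict initial
  segment only, at limits this value is the supremum.\<close>

lemma normal_function:
  assumes U: "succ_seg U p" and D: "club_in U D"
    and loc: "\<And>f g k. (\<And>j. j \<preceq> k \<Longrightarrow> f j = g j) \<Longrightarrow> \<Psi> f k = \<Psi> g k"
    and small: "\<And>f k. k \<in> U \<Longrightarrow> (\<And>j. j \<preceq> k \<Longrightarrow> f j \<in> U) \<Longrightarrow> \<Psi> f k \<subseteq> U \<and> cle (\<Psi> f k) (seg p)"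
  obtains \<xi> where "\<And>i. i \<in> U \<Longrightarrow> \<xi> i \<in> D" "\<And>i k. i \<in> U \<Longrightarrow> k \<prec> i \<Longrightarrow> \<xi> k \<prec> \<xi> i"
    "\<And>i k x. i \<in> U \<Longrightarrow> k \<prec> i \<Longrightarrow> x \<in> \<Psi> \<xi> k \<Longrightarrow> x \<prec> \<xi> i"
    "\<And>i y. i \<in> U \<Longrightarrow> is_limit R i \<Longrightarrow> y \<prec> \<xi> i \<Longrightarrow> \<exists>k. k \<prec> i \<and> y \<prec> \<xi> k"
proof -
  define P where "P f i y \<longleftrightarrow> y \<in> D \<and> (\<forall>k. k \<prec> i \<longrightarrow> f k \<prec> y \<and> (\<forall>x\<in>\<Psi> f k. x \<prec> y))" for f i y
  have "P f x = P g x" if "\<And>y. y \<prec> x \<Longrightarrow> f y = g y" for f g x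
  proof -
    have "\<Psi> f k = \<Psi> g k" if "k \<prec> x" for k
      by (rule loc) (use \<open>k \<prec> x\<close> \<open>\<And>y. y \<prec> x \<Longrightarrow> f y = g y\<close> in \<open>blast intro: ord.le_less_trans\<close>)
    then show ?thesis
      using that unfolding P_def by (intro ext) auto
  qed
  then obtain \<xi> where \<xi>: "\<And>i. \<xi> i = least (P \<xi> i)"
    using wf_recursion[of "\<lambda>f i. least (P f i)"] by metis
  have down: "\<And>x y. x \<in> U \<Longrightarrow> y \<preceq> x \<Longrightarrow> y \<in> U"
    using U unfolding succ_seg_def by (metis ord.le_less seg_iff subsetD)
  have main: "P \<xi> i (\<xi> i)" if "i \<in> U" for i
    using that
  proof (induction i rule: ord.less_induct)
    case (less i)
    have in_U: "\<xi> k \<in> U" if "k \<prec> i" for k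
      using less.IH[OF that] down[OF less.prems, of k] that D
      unfolding P_def club_in_def by (auto simp: ord.le_less)
    define X where "X = \<xi> ` seg i \<union> (\<Union>k\<in>seg i. \<Psi> \<xi> k)"
    have *: "\<Psi> \<xi> k \<subseteq> U \<and> cle (\<Psi> \<xi> k) (seg p)" if "k \<prec> i" for k
      by (rule small) (use that in_U less.prems down in \<open>auto intro: ord.le_less_trans ord.less_imp_le\<close>)
    have "cle (\<Union>k\<in>seg i. \<Psi> \<xi> k) (seg p)"
      by (rule cle_UN) (use U less.prems * in \<open>auto simp: succ_seg_def\<close>)
    moreover have "cle (\<xi> ` seg i) (seg p)"
      using U less.prems cle_trans[OF cle_image] unfolding succ_seg_def by blast
    ultimately have "cle X (seg p)"
      unfolding X_def using cle_Un U unfolding succ_seg_def by blast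
    moreover have "X \<subseteq> U"
      unfolding X_def by (simp add: image_subset_iff UN_subset_iff in_U *)
    ultimately obtain y where y: "y \<in> U" "\<forall>x\<in>X. x \<prec> y"
      using succ_seg_bounded[OF U] by blast
    then obtain z where "z \<in> D" "y \<prec> z"
      using D unfolding club_in_def by blast
    moreover have "\<forall>x\<in>X. x \<prec> z"
      using y(2) ord.less_trans[OF _ \<open>y \<prec> z\<close>] by blast
    ultimately have "P \<xi> i z"
      unfolding P_def X_def by (simp add: ball_Un)
    then have "P \<xi> i (least (P \<xi> i))"
      by (rule leastI)
    then show ?case
      by (simp only: \<xi>[symmetric])
  qed
  have cont: "\<exists>k. k \<prec> i \<and> y \<prec> \<xi> k" if i: "i \<in> U" "is_limit R i" and y: "y \<prec> \<xi> i" for i y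
  proof (rule ccontr)
    assume neg: "\<not> ?thesis"
    have sU: "k \<in> U" if "k \<prec> i" for k
      using down i that by (auto simp: ord.le_less)
    have nxt: "\<exists>k'. k \<prec> k' \<and> k' \<prec> i" if "k \<prec> i" for k
      by (rule limitD[OF i(2) that])
    have below_y: "\<xi> k \<prec> y" if "k \<prec> i" for k
    proof -
      obtain k' where "k \<prec> k'" "k' \<prec> i" using nxt[OF \<open>k \<prec> i\<close>] by blast
      then have "\<xi> k \<prec> \<xi> k'" "\<xi> k' \<preceq> y"
        using main[OF sU] neg ord.not_less unfolding P_def by blast+
      then show ?thesis by (rule ord.less_le_trans)
    qed
    \<comment> \<open>The supremum of the earlier values is itself admissible: it is a limit point
      of \<open>D\<close>, and a bound imposed at stage k is already respected by the value at some
      later k' below i. Being smaller than \<open>\<xi> i\<close>, it contradicts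
      minimality.\<close>
    define s where "s = least (\<lambda>z. \<forall>k. k \<prec> i \<longrightarrow> \<xi> k \<prec> z)"
    have s1: "\<And>k. k \<prec> i \<Longrightarrow> \<xi> k \<prec> s"
      unfolding s_def using leastI[of "\<lambda>z. \<forall>k. k \<prec> i \<longrightarrow> \<xi> k \<prec> z" y] below_y by blast
    have "s \<preceq> y"
      unfolding s_def by (rule least_le) (use below_y in blast)
    then have s2: "s \<prec> \<xi> i"
      using y by (rule ord.le_less_trans)
    have "\<xi> i \<in> U"
      using main[OF i(1)] D unfolding P_def club_in_def by blast
    then have "s \<in> U"
      using down s2 by (auto simp: ord.le_less)
    moreover have "lp D s"
      unfolding lp_def
    proof (intro conjI allI impI)
      show "seg s \<noteq> {}"
        using i(2) s1 unfolding is_limit_def by (metis empty_iff equals0I seg_iff)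
      fix z assume "z \<prec> s"
      then obtain k where k: "k \<prec> i" "z \<preceq> \<xi> k"
        unfolding s_def using not_less_least ord.not_less by blast
      then obtain k' where "k \<prec> k'" "k' \<prec> i" using nxt by blast
      then have "z \<prec> \<xi> k'" "\<xi> k' \<in> D" "\<xi> k' \<prec> s"
        using main[OF sU] s1 k ord.le_less_trans unfolding P_def by blast+
      then show "\<exists>e\<in>D. z \<prec> e \<and> e \<prec> s" by blast
    qed
    ultimately have "s \<in> D"
      using D unfolding club_in_def by blast
    moreover have "x \<prec> s" if "k \<prec> i" "x \<in> \<Psi> \<xi> k" for k x
    proof -
      obtain k' where "k \<prec> k'" "k' \<prec> i" using nxt[OF \<open>k \<prec> i\<close>] by blast
      then have "x \<prec> \<xi> k'" "\<xi> k' \<prec> s"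
        using main[OF sU] s1 that unfolding P_def by blast+
      then show ?thesis by (rule ord.less_trans)
    qed
    ultimately have "P \<xi> i s"
      unfolding P_def using s1 by blast
    then have "\<xi> i \<preceq> s"
      unfolding \<xi>[of i] by (rule least_le)
    then show False
      using s2 ord.leD by blast
  qed
  show ?thesis
    by (rule that[of \<xi>]) (use main cont in \<open>unfold P_def, blast+\<close>)
qed

section \<open>Cardinals, cofinality and pigeonhole arguments\<close>

lemma cardinal_less: "is_cardinal R t \<Longrightarrow> \<beta> \<prec> t \<Longrightarrow> \<not> cle (seg t) (seg \<beta>)"
  unfolding is_cardinal_def cless_iff by blast

lemma cardinal_limit:
  assumes "is_cardinal R t" "infinite (seg t)"
  shows "is_limit R t"
  unfolding is_limit_def
proof (intro conjI ballI)
  show "seg t \<noteq> {}" using assms by auto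
  fix \<beta> assume "\<beta> \<in> seg t"
  then have b: "\<not> cle (seg t) (seg \<beta>)" using cardinal_less assms by simp
  show "\<exists>\<gamma>\<in>seg t. \<beta> \<prec> \<gamma>"
  proof (rule ccontr)
    assume "\<not> ?thesis"
    then have eq: "seg t \<subseteq> insert \<beta> (seg \<beta>)"
      by (auto simp: ord.not_less ord.le_less)
    then have "infinite (seg \<beta>)"
      using assms(2) finite_subset by auto
    then have "cle (insert \<beta> (seg \<beta>)) (seg \<beta>)"
      by (simp add: cle_insert)
    then show False
      using b eq cle_subset cle_trans by blast
  qed
qed

lemma cf_unique: "cf_is R \<alpha> t \<Longrightarrow> cf_is R \<alpha> t' \<Longrightarrow> t = t'"
  unfolding cf_is_def ceq_iff
  by (meson cardinal_less cle_trans ord.linorder_cases)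

lemma cf_limit:
  assumes cf: "cf_is R \<alpha> t" and inf: "infinite (seg t)"
  shows "is_limit R \<alpha>"
  unfolding is_limit_def
proof (intro conjI ballI)
  obtain B where B: "cofinal_in R B \<alpha>" "ceq B (seg t)"
    using cf unfolding cf_is_def by blast
  then have "infinite B"
    using inf cle_infinite unfolding ceq_iff by blast
  then show "seg \<alpha> \<noteq> {}"
    using B unfolding cofinal_in_def by auto
  fix \<beta> assume b: "\<beta> \<in> seg \<alpha>"
  show "\<exists>\<gamma>\<in>seg \<alpha>. \<beta> \<prec> \<gamma>"
  proof (rule ccontr)
    assume "\<not> ?thesis"
    then have "cofinal_in R {\<beta>} \<alpha>"
      unfolding cofinal_in_def using b by (auto simp: ord.not_less)
    then have "cle (seg t) {\<beta>}"
      using cf unfolding cf_is_def by blast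
    then show False
      using inf cle_infinite by blast
  qed
qed

lemma regular_bounded:
  assumes "cf_is R t t" "X \<subseteq> seg t" "\<not> cle (seg t) X"
  shows "\<exists>b. b \<prec> t \<and> (\<forall>x\<in>X. x \<prec> b)"
  using assms unfolding cf_is_def cofinal_in_def by (metis ord.not_le seg_iff)

text \<open>Index \<theta> many elements of \<open>Y\<close> by \<open>t\<close>. If all fibres were
  small, each would have bounded indices, and fewer than \<theta> bounds have a common bound c below
  \<open>t\<close>; but the index c itself belongs to a fibre.\<close>

lemma pigeonhole:
  assumes reg: "cf_is R t t" and Y: "cle (seg t) Y" and f: "\<not> cle (seg t) (f ` Y)"
  shows "\<exists>z\<in>f ` Y. cle (seg t) {y\<in>Y. f y = z}"
proof (rule ccontr)
  assume neg: "\<not> ?thesis"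
  obtain k where k: "inj_on k (seg t)" "k ` seg t \<subseteq> Y"
    using Y unfolding cle_iff by blast
  have "\<exists>b. b \<prec> t \<and> (\<forall>j. j \<prec> t \<and> f (k j) = z \<longrightarrow> j \<prec> b)" if z: "z \<in> f ` Y" for z
  proof -
    have "cle {j\<in>seg t. f (k j) = z} {y\<in>Y. f y = z}"
      by (rule cleI[of k]) (use k in \<open>auto simp: inj_on_def\<close>)
    then have "\<not> cle (seg t) {j\<in>seg t. f (k j) = z}"
      using neg z cle_trans by blast
    then show ?thesis
      using regular_bounded[OF reg, of "{j\<in>seg t. f (k j) = z}"] by fastforce
  qed
  then obtain b where b: "\<And>z. z \<in> f ` Y \<Longrightarrow> b z \<prec> t \<and> (\<forall>j. j \<prec> t \<and> f (k j) = z \<longrightarrow> j \<prec> b z)"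
    by metis
  have "\<not> cle (seg t) (b ` f ` Y)"
    using f cle_image cle_trans by blast
  then obtain c where c: "c \<prec> t" "\<forall>z\<in>f ` Y. b z \<prec> c"
    using regular_bounded[OF reg, of "b ` f ` Y"] b by (metis image_subsetI imageI seg_iff)
  have "f (k c) \<in> f ` Y"
    using k c(1) by (metis image_eqI image_subset_iff seg_iff)
  then have "c \<prec> b (f (k c))" "b (f (k c)) \<prec> c"
    using b c by blast+
  then show False
    using ord.less_asym by blast
qed

text \<open>Otherwise the values of \<open>r\<close> are cofinal in \<lambda>. A cofinal set of size
  less than \<theta> would, by the pigeonhole principle, have one element above \<theta> many
  values, so \<theta> would be the cofinality of \<lambda>.\<close>

lemma small_target:
  assumes reg: "cf_is R t t" and l: "is_cardinal R l" and inf: "infinite (seg l)" and ne: "\<not> cf_is R l t"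
    and Y: "ceq Y (seg t)" and r: "\<And>y. y \<in> Y \<Longrightarrow> r y \<prec> l"
  shows "\<exists>i. i \<prec> l \<and> cle (seg t) {y\<in>Y. r y \<prec> i}"
proof (rule ccontr)
  assume neg: "\<not> ?thesis"
  have cof: "cofinal_in R (r ` Y) l"
    unfolding cofinal_in_def
  proof (intro conjI ballI)
    fix \<beta> assume "\<beta> \<in> seg l"
    then have "\<not> cle (seg t) {y\<in>Y. r y \<prec> \<beta>}"
      using neg by auto
    then have "{y\<in>Y. r y \<prec> \<beta>} \<noteq> Y"
      using Y unfolding ceq_iff by metis
    then show "\<exists>b\<in>r ` Y. \<beta> \<preceq> b"
      using ord.not_less by blast
  qed (use r in auto)
  have min: "cle (seg t) B" if B: "cofinal_in R B l" for B
  proof (rule ccontr)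
    assume small: "\<not> cle (seg t) B"
    have "\<exists>b\<in>B. r y \<preceq> b" if "y \<in> Y" for y
      using B r[OF that] unfolding cofinal_in_def by simp
    then obtain b where b: "\<And>y. y \<in> Y \<Longrightarrow> b y \<in> B \<and> r y \<preceq> b y"
      by metis
    then have "\<not> cle (seg t) (b ` Y)"
      using small cle_trans cle_subset by (metis image_subsetI)
    then obtain z where z: "z \<in> b ` Y" "cle (seg t) {y\<in>Y. b y = z}"
      using pigeonhole[OF reg, of Y b] Y unfolding ceq_iff by blast
    have "z \<in> B"
      using z(1) b by blast
    then have "z \<prec> l"
      using B unfolding cofinal_in_def by auto
    then obtain i where i: "i \<prec> l" "z \<prec> i"
      using limitD[OF cardinal_limit[OF l inf]] by blast
    have "{y\<in>Y. b y = z} \<subseteq> {y\<in>Y. r y \<prec> i}"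
      using b i(2) ord.le_less_trans by blast
    then show False
      using neg i(1) z(2) cle_trans cle_subset by blast
  qed
  have "cf_is R l t"
    unfolding cf_is_def
  proof (intro conjI exI allI impI)
    show "is_cardinal R t" using reg unfolding cf_is_def by blast
    show "cofinal_in R (r ` Y) l" by (rule cof)
    show "ceq (r ` Y) (seg t)"
      using min[OF cof] cle_image cle_trans Y unfolding ceq_iff by blast
  qed (rule min)
  then show False
    using ne by blast
qed

text \<open>For regular \<open>t\<close> these are exactly the cofinal subsets of \<open>\<alpha>\<close> of order type \<open>t\<close>.\<close>

definition thin :: "'a \<Rightarrow> 'a \<Rightarrow> 'a set \<Rightarrow> bool" where
  "thin t \<alpha> A \<longleftrightarrow> A \<subseteq> seg \<alpha> \<and> ceq A (seg t) \<and> (\<forall>\<beta>. \<beta> \<prec> \<alpha> \<longrightarrow> \<not> cle (seg t) (A \<inter> seg \<beta>))"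

lemma thin_cofinal:
  assumes "thin t \<alpha> A" "A' \<subseteq> A" "cle (seg t) A'" "\<beta> \<prec> \<alpha>"
  shows "\<exists>a\<in>A'. \<beta> \<preceq> a"
proof (rule ccontr)
  assume "\<not> ?thesis"
  then have "A' \<subseteq> A \<inter> seg \<beta>"
    using assms(2) ord.not_le by auto
  then show False
    using assms cle_subset cle_trans unfolding thin_def by blast
qed

text \<open>Enumerate a cofinal set along \<open>t\<close> and keep the values that exceed all
  earlier ones. Those below \<beta> have indices below any index whose value reaches \<beta>, hence
  there are too few of them.\<close>

lemma thin_exists:
  assumes cf: "cf_is R \<alpha> t"
  shows "\<exists>A. thin t \<alpha> A \<and> cofinal_in R A \<alpha>"
proof -
  obtain B where B: "cofinal_in R B \<alpha>" "ceq B (seg t)" and t: "is_cardinal R t"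
    using cf unfolding cf_is_def by blast
  have min: "\<And>B. cofinal_in R B \<alpha> \<Longrightarrow> cle (seg t) B"
    using cf unfolding cf_is_def by blast
  show ?thesis
  proof (cases "B = {}")
    case True
    then have "seg t = {}"
      using B unfolding ceq_iff cle_iff by auto
    moreover have "seg \<alpha> = {}"
      using B(1) True unfolding cofinal_in_def by blast
    ultimately show ?thesis
      using B True unfolding thin_def cofinal_in_def using seg_iff by blast
  next
    case False
    then obtain \<phi> where \<phi>: "\<phi> ` seg t = B"
      using B(2) cle_inv unfolding ceq_iff by blast
    define A where "A = {\<phi> x | x. x \<prec> t \<and> (\<forall>y. y \<prec> x \<longrightarrow> \<phi> y \<prec> \<phi> x)}"
    have AB: "A \<subseteq> B"
      unfolding A_def using \<phi> by auto
    have hit: "\<exists>x. x \<prec> t \<and> \<beta> \<preceq> \<phi> x" if "\<beta> \<prec> \<alpha>" for \<beta>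
    proof -
      have "\<exists>b\<in>\<phi> ` seg t. \<beta> \<preceq> b"
        using B(1) that unfolding \<phi> cofinal_in_def by simp
      then show ?thesis by auto
    qed
    have cof: "cofinal_in R A \<alpha>"
      unfolding cofinal_in_def
    proof (intro conjI ballI)
      show "A \<subseteq> seg \<alpha>"
        using AB B(1) unfolding cofinal_in_def by blast
      fix \<beta> assume "\<beta> \<in> seg \<alpha>"
      then obtain x where x: "x \<prec> t \<and> \<beta> \<preceq> \<phi> x"
        using hit by auto
      define z where "z = least (\<lambda>x. x \<prec> t \<and> \<beta> \<preceq> \<phi> x)"
      have z: "z \<prec> t" "\<beta> \<preceq> \<phi> z"
        unfolding z_def using leastI[of "\<lambda>x. x \<prec> t \<and> \<beta> \<preceq> \<phi> x", OF x] by blast+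
      have "\<phi> y \<prec> \<phi> z" if "y \<prec> z" for y
      proof -
        have "\<not> (y \<prec> t \<and> \<beta> \<preceq> \<phi> y)"
          using not_less_least that unfolding z_def by blast
        then have "\<phi> y \<prec> \<beta>"
          using ord.less_trans[OF that z(1)] ord.not_le by blast
        then show ?thesis
          using z(2) ord.less_le_trans by blast
      qed
      then have "\<phi> z \<in> A"
        unfolding A_def using z by blast
      then show "\<exists>b\<in>A. \<beta> \<preceq> b"
        using z by blast
    qed
    have "\<not> cle (seg t) (A \<inter> seg \<beta>)" if "\<beta> \<prec> \<alpha>" for \<beta>
    proof -
      obtain x where x: "x \<prec> t" "\<beta> \<preceq> \<phi> x"
        using hit \<open>\<beta> \<prec> \<alpha>\<close> by blast
      have "A \<inter> seg \<beta> \<subseteq> \<phi> ` seg x"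
      proof
        fix a assume "a \<in> A \<inter> seg \<beta>"
        then obtain y where y: "a = \<phi> y" "y \<prec> t" "\<forall>y'. y' \<prec> y \<longrightarrow> \<phi> y' \<prec> \<phi> y" "\<phi> y \<prec> \<beta>"
          unfolding A_def by auto
        have "\<phi> y \<prec> \<phi> x"
          using y(4) x(2) by (rule ord.less_le_trans)
        then have "y \<prec> x"
          using y(3) by (metis ord.less_asym ord.less_irrefl ord.linorder_cases)
        then show "a \<in> \<phi> ` seg x"
          using y(1) by simp
      qed
      then have "cle (A \<inter> seg \<beta>) (seg x)"
        by (rule cle_surj)
      then show ?thesis
        using cardinal_less[OF t x(1)] cle_trans by blast
    qed
    moreover have "ceq A (seg t)"
      using min[OF cof] AB B(2) cle_subset cle_trans unfolding ceq_iff by blast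
    ultimately have "thin t \<alpha> A"
      unfolding thin_def using cof unfolding cofinal_in_def by blast
    then show ?thesis
      using cof by blast
  qed
qed

text \<open>Sending b to the first index whose value reaches b turns a cofinal subset of \<alpha>
  into a cofinal subset of \<open>t\<close>, so regularity of \<open>t\<close> bounds its size from
  below.\<close>

lemma cf_from_map:
  assumes reg: "cf_is R t t" and inc: "\<And>i j. i \<prec> j \<Longrightarrow> j \<prec> t \<Longrightarrow> \<phi> i \<prec> \<phi> j"
    and into: "\<And>i. i \<prec> t \<Longrightarrow> \<phi> i \<prec> \<alpha>" and cof: "\<And>y. y \<prec> \<alpha> \<Longrightarrow> \<exists>i. i \<prec> t \<and> y \<preceq> \<phi> i"
  shows "cf_is R \<alpha> t"
  unfolding cf_is_def
proof (intro conjI exI allI impI)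
  have inj: "inj_on \<phi> (seg t)"
    by (rule inj_onI) (metis inc ord.less_irrefl ord.linorder_cases seg_iff)
  show "is_cardinal R t" using reg unfolding cf_is_def by blast
  show "cofinal_in R (\<phi> ` seg t) \<alpha>"
    unfolding cofinal_in_def using into cof by (auto simp: Bex_def)
  show "ceq (\<phi> ` seg t) (seg t)"
    unfolding ceq_iff using cle_image cle_inj_image[OF inj] by blast
  fix B assume B: "cofinal_in R B \<alpha>"
  define h where "h b = least (\<lambda>i. i \<prec> t \<and> b \<preceq> \<phi> i)" for b
  have h: "h b \<prec> t \<and> b \<preceq> \<phi> (h b)" if "b \<prec> \<alpha>" for b
    unfolding h_def using leastI[of "\<lambda>i. i \<prec> t \<and> b \<preceq> \<phi> i"] cof[OF that] by blast
  have "cofinal_in R (h ` B) t"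
    unfolding cofinal_in_def
  proof (intro conjI ballI)
    show "h ` B \<subseteq> seg t"
      using h B unfolding cofinal_in_def by auto
    fix \<beta> assume "\<beta> \<in> seg t"
    then have "\<phi> \<beta> \<prec> \<alpha>" and bt: "\<beta> \<prec> t"
      using into by auto
    then obtain b where b: "b \<in> B" "\<phi> \<beta> \<preceq> b"
      using cofinalD[OF B] by blast
    then have "b \<prec> \<alpha>"
      using cofinal_below[OF B] by blast
    then have "\<phi> \<beta> \<preceq> \<phi> (h b)" "h b \<prec> t"
      using h b ord.order_trans by blast+
    then have "\<beta> \<preceq> h b"
      using inc bt by (metis ord.leD ord.not_le)
    then show "\<exists>b\<in>h ` B. \<beta> \<preceq> b"
      using b by blast
  qed
  then have "cle (seg t) (h ` B)"
    using reg unfolding cf_is_def by blast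
  then show "cle (seg t) B"
    using cle_image cle_trans by blast
qed

lemma Restr_field: "Field (Restr R A) = A"
  unfolding Field_def by auto

text \<open>Otherwise one of the two orders is isomorphic to a proper initial segment of the other,
  but proper initial segments of either have fewer than \<theta> elements.\<close>

lemma thin_ordIso:
  assumes A: "thin t \<alpha> A" and t: "is_cardinal R t"
  shows "(Restr R A, Restr R (seg t)) \<in> ordIso"
proof -
  let ?A = "Restr R A" and ?T = "Restr R (seg t)"
  have W: "Well_order ?A" "Well_order ?T"
    using wo Well_order_Restr by blast+
  have cle_iso: "cle X (Y \<inter> seg y)"
    if iso: "(Restr R X, Restr (Restr R Y) (underS (Restr R Y) y)) \<in> ordIso" and y: "y \<in> Y" for X Y y
  proof -
    have "underS (Restr R Y) y = Y \<inter> seg y"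
      using y unfolding underS_def below_def olt_def by auto
    then have "Restr (Restr R Y) (underS (Restr R Y) y) = Restr R (Y \<inter> seg y)"
      by auto
    then obtain f where "iso (Restr R X) (Restr R (Y \<inter> seg y)) f"
      using iso unfolding ordIso_def by auto
    then have "bij_betw f X (Y \<inter> seg y)"
      unfolding iso_iff2 Restr_field by blast
    then show ?thesis
      unfolding cle_iff bij_betw_def by blast
  qed
  have "(?A, ?T) \<notin> ordLess"
  proof
    assume "(?A, ?T) \<in> ordLess"
    then obtain x where x: "x \<prec> t" "(?A, Restr ?T (underS ?T x)) \<in> ordIso"
      using ordLess_iff_ordIso_Restr[OF W(2) W(1)] by (auto simp: Restr_field)
    then have "cle A (seg t \<inter> seg x)"
      using cle_iso by simp
    then have "cle (seg t) (seg x)"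
      using A cle_trans[OF _ cle_trans] cle_subset[of "seg t \<inter> seg x" "seg x"]
      unfolding thin_def ceq_iff by blast
    then show False
      using cardinal_less[OF t x(1)] by blast
  qed
  moreover have "(?T, ?A) \<notin> ordLess"
  proof
    assume "(?T, ?A) \<in> ordLess"
    then obtain x where x: "x \<in> A" "(?T, Restr ?A (underS ?A x)) \<in> ordIso"
      using ordLess_iff_ordIso_Restr[OF W(1) W(2)] by (auto simp: Restr_field)
    then have "cle (seg t) (A \<inter> seg x)"
      using cle_iso by simp
    then show False
      using A x(1) unfolding thin_def by auto
  qed
  ultimately show ?thesis
    using not_ordLeq_iff_ordLess[OF W] not_ordLeq_iff_ordLess[OF W(2) W(1)] ordIso_iff_ordLeq by blast
qed

lemma thin_if_ordIso:
  assumes iso: "(Restr R A, Restr R (seg t)) \<in> ordIso" and A: "cofinal_in R A \<alpha>" and t: "is_cardinal R t"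
  shows "thin t \<alpha> A"
proof -
  obtain f where "iso (Restr R A) (Restr R (seg t)) f"
    using iso unfolding ordIso_def by auto
  then have f: "bij_betw f A (seg t)" "\<And>a b. a \<in> A \<Longrightarrow> b \<in> A \<Longrightarrow> a \<preceq> b \<longleftrightarrow> f a \<preceq> f b"
    unfolding iso_iff2 Restr_field by (auto simp: bij_betw_def)
  have "\<not> cle (seg t) (A \<inter> seg \<beta>)" if "\<beta> \<prec> \<alpha>" for \<beta>
  proof -
    obtain a where a: "a \<in> A" "\<beta> \<preceq> a"
      using cofinalD[OF A \<open>\<beta> \<prec> \<alpha>\<close>] by blast
    have "cle (A \<inter> seg \<beta>) (seg (f a))"
    proof (rule cleI[of f])
      show "inj_on f (A \<inter> seg \<beta>)"
        using f(1) unfolding bij_betw_def inj_on_def by blast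
      fix x assume x: "x \<in> A \<inter> seg \<beta>"
      then have "\<not> a \<preceq> x"
        using a(2) ord.less_le_trans ord.not_le by auto
      then show "f x \<in> seg (f a)"
        using f(2)[OF a(1)] x ord.not_le by auto
    qed
    moreover have "f a \<prec> t"
      using f(1) a(1) unfolding bij_betw_def by auto
    ultimately show ?thesis
      using cardinal_less[OF t] cle_trans by blast
  qed
  moreover have "ceq A (seg t)"
    using f(1) card_of_ordIso unfolding ceq_def by blast
  ultimately show ?thesis
    using A unfolding thin_def cofinal_in_def by blast
qed

lemma thin_map:
  assumes A: "thin t \<alpha> A" and t: "is_cardinal R t"
  shows "\<exists>\<phi>. \<phi> ` seg t = A \<and> (\<forall>i j. i \<prec> j \<and> j \<prec> t \<longrightarrow> \<phi> i \<prec> \<phi> j)"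
proof -
  obtain f where "iso (Restr R (seg t)) (Restr R A) f"
    using ordIso_symmetric[OF thin_ordIso[OF assms]] unfolding ordIso_def by auto
  then have f: "bij_betw f (seg t) A" "\<And>a b. a \<prec> t \<Longrightarrow> b \<prec> t \<Longrightarrow> a \<preceq> b \<longleftrightarrow> f a \<preceq> f b"
    unfolding iso_iff2 Restr_field by (auto simp: bij_betw_def)
  have "f i \<prec> f j" if "i \<prec> j" "j \<prec> t" for i j
    using f(2)[of j i] that ord.less_trans[OF that] ord.not_le by blast
  then show ?thesis
    using f(1) unfolding bij_betw_def by blast
qed

subsection \<open>Club guessing\<close>

lemma thin_cf:
  assumes A: "thin t \<alpha> A" and reg: "cf_is R t t"
  shows "cf_is R \<alpha> t"
proof -
  have t: "is_cardinal R t"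
    using reg unfolding cf_is_def by blast
  obtain \<phi> where \<phi>: "\<phi> ` seg t = A" "\<And>i j. i \<prec> j \<Longrightarrow> j \<prec> t \<Longrightarrow> \<phi> i \<prec> \<phi> j"
    using thin_map[OF A t] by blast
  have A': "A \<subseteq> seg \<alpha>" "cle (seg t) A"
    using A unfolding thin_def ceq_iff by blast+
  show ?thesis
  proof (rule cf_from_map[OF reg \<phi>(2)])
    show "\<phi> i \<prec> \<alpha>" if "i \<prec> t" for i
      using that \<phi>(1) A'(1) by (metis imageI seg_iff subsetD)
    show "\<exists>i. i \<prec> t \<and> y \<preceq> \<phi> i" if "y \<prec> \<alpha>" for y
      using thin_cofinal[OF A order_refl A'(2) that] unfolding \<phi>(1)[symmetric] by auto
  qed
qed

text \<open>The largest element of \<open>E\<close> that is at most \<open>\<gamma>\<close>; if there is none, the value is the least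
  ordinal, which need not lie in \<open>E\<close>.\<close>

definition floor_in :: "'a set \<Rightarrow> 'a \<Rightarrow> 'a" where
  "floor_in E \<gamma> = least (\<lambda>x. \<forall>e\<in>E. e \<preceq> \<gamma> \<longrightarrow> e \<preceq> x)"

lemma floor_upper: "e \<in> E \<Longrightarrow> e \<preceq> \<gamma> \<Longrightarrow> e \<preceq> floor_in E \<gamma>"
  unfolding floor_in_def using leastI[of "\<lambda>x. \<forall>e\<in>E. e \<preceq> \<gamma> \<longrightarrow> e \<preceq> x" \<gamma>] by blast

lemma floor_le: "floor_in E \<gamma> \<preceq> \<gamma>"
  unfolding floor_in_def by (rule least_le) blast

lemma floor_mono: "E' \<subseteq> E \<Longrightarrow> floor_in E' \<gamma> \<preceq> floor_in E \<gamma>"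
  unfolding floor_in_def[of E'] by (rule least_le) (use floor_upper in blast)

text \<open>A supremum of elements of \<open>E\<close> that is not attained is a limit point of
  \<open>E\<close>, hence in \<open>E\<close> by closure. The hypothesis on \<open>e\<close>
  excludes the default value.\<close>

lemma floor_mem:
  assumes E: "club_in (seg \<sigma>) E" and \<gamma>: "\<gamma> \<prec> \<sigma>" and e: "e \<in> E" "e \<preceq> \<gamma>"
  shows "floor_in E \<gamma> \<in> E"
proof (rule ccontr)
  assume no: "floor_in E \<gamma> \<notin> E"
  have below: "e \<prec> floor_in E \<gamma>" if "e \<in> E" "e \<preceq> \<gamma>" for e
    using floor_upper[OF that] that(1) no by (metis ord.le_less)
  have "lp E (floor_in E \<gamma>)"
    unfolding lp_def
  proof (intro conjI allI impI)
    show "seg (floor_in E \<gamma>) \<noteq> {}"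
      using below[OF e] by auto
    fix y assume "y \<prec> floor_in E \<gamma>"
    then have "\<not> (\<forall>e\<in>E. e \<preceq> \<gamma> \<longrightarrow> e \<preceq> y)"
      unfolding floor_in_def by (rule not_less_least)
    then obtain e' where "e' \<in> E" "e' \<preceq> \<gamma>" "y \<prec> e'"
      by (auto simp: ord.not_le)
    then show "\<exists>e\<in>E. y \<prec> e \<and> e \<prec> floor_in E \<gamma>"
      using below by blast
  qed
  moreover have "floor_in E \<gamma> \<in> seg \<sigma>"
    using ord.le_less_trans[OF floor_le \<gamma>] by simp
  ultimately show False
    using E no unfolding club_in_def by blast
qed

text \<open>Shelah's device of pushing a ladder \<open>c\<close> down onto a club. Elements of
  \<open>c\<close> with nothing of \<open>E\<close> below or at them are dropped, because their
  \<open>floor_in\<close> is only a default.\<close>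

definition proj :: "'a set \<Rightarrow> 'a set \<Rightarrow> 'a set" where
  "proj E c = floor_in E ` {\<gamma>\<in>c. \<exists>e\<in>E. e \<preceq> \<gamma>}"

text \<open>Pushing down never moves a point across an element of \<open>E\<close>, and
  \<open>E\<close> is unbounded in \<epsilon>. So the image stays cofinal, and its part below y
  comes from the part of \<open>c\<close> below some e in \<open>E\<close> above y.\<close>

lemma thin_proj:
  assumes E: "club_in (seg \<sigma>) E" and \<epsilon>: "\<epsilon> \<prec> \<sigma>" "lp E \<epsilon>" and c: "thin t \<epsilon> c" and reg: "cf_is R t t"
  shows "thin t \<epsilon> (proj E c)"
proof -
  have c': "c \<subseteq> seg \<epsilon>" "cle (seg t) c" "cle c (seg t)"
    using c unfolding thin_def ceq_iff by blast+
  have sub: "x \<prec> \<epsilon>" if "x \<in> proj E c" for x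
  proof -
    obtain \<gamma> where \<gamma>: "\<gamma> \<in> c" "x = floor_in E \<gamma>"
      using \<open>x \<in> proj E c\<close> unfolding proj_def by blast
    have "\<gamma> \<prec> \<epsilon>"
      using subsetD[OF c'(1) \<gamma>(1)] by simp
    then show ?thesis
      unfolding \<gamma>(2) by (rule ord.le_less_trans[OF floor_le])
  qed
  have "cofinal_in R (proj E c) \<epsilon>"
  proof (rule cofinalI[OF sub])
    fix y assume "y \<prec> \<epsilon>"
    then obtain e where e: "e \<in> E" "y \<prec> e" "e \<prec> \<epsilon>"
      using \<epsilon>(2) unfolding lp_def by blast
    obtain \<gamma> where \<gamma>: "\<gamma> \<in> c" "e \<preceq> \<gamma>"
      using thin_cofinal[OF c order_refl c'(2) e(3)] by blast
    have "floor_in E \<gamma> \<in> proj E c"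
      unfolding proj_def using \<gamma> e(1) by blast
    moreover have "y \<preceq> floor_in E \<gamma>"
      using floor_upper[OF e(1) \<gamma>(2)] e(2) ord.less_imp_le ord.order_trans by blast
    ultimately show "\<exists>b\<in>proj E c. y \<preceq> b"
      by blast
  qed
  then have 1: "cle (seg t) (proj E c)"
    using thin_cf[OF c reg] unfolding cf_is_def by blast
  have 2: "cle (proj E c) (seg t)"
    unfolding proj_def by (rule cle_image_le) (rule cle_trans[OF cle_subset c'(3)], blast)
  have 3: "\<not> cle (seg t) (proj E c \<inter> seg y)" if "y \<prec> \<epsilon>" for y
  proof -
    obtain e where e: "e \<in> E" "y \<prec> e" "e \<prec> \<epsilon>"
      using \<open>y \<prec> \<epsilon>\<close> \<epsilon>(2) unfolding lp_def by blast
    have "proj E c \<inter> seg y \<subseteq> floor_in E ` (c \<inter> seg e)"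
    proof
      fix x assume "x \<in> proj E c \<inter> seg y"
      then obtain \<gamma> where \<gamma>: "\<gamma> \<in> c" "x = floor_in E \<gamma>" "x \<prec> y"
        unfolding proj_def by auto
      have "\<not> e \<preceq> \<gamma>"
        using floor_upper[OF e(1), of \<gamma>] \<gamma>(2,3) e(2) by (metis ord.leD ord.less_trans)
      then show "x \<in> floor_in E ` (c \<inter> seg e)"
        using \<gamma> by (auto simp: ord.not_le)
    qed
    then have "cle (proj E c \<inter> seg y) (c \<inter> seg e)"
      by (rule cle_surj)
    then show ?thesis
      using c e(3) cle_trans unfolding thin_def by blast
  qed
  show ?thesis
    unfolding thin_def ceq_iff using sub 1 2 3 by auto
qed

text \<open>If no club \<open>E\<close> yielded a guessing sequence by projection, one could shrink the clubs \<open>s\<close> many times.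
  But \<open>floor_in E \<gamma>\<close> only decreases when \<open>E\<close> shrinks, so for the \<open>t\<close> many \<open>\<gamma>\<close> that matter
  all these values are constant from some step before \<open>s\<close> on.\<close>

lemma club_guessing:
  assumes s: "succ_seg (seg s) t" and \<sigma>: "succ_seg (seg \<sigma>) s" and reg: "cf_is R t t" and t\<sigma>: "t \<prec> \<sigma>"
  shows "\<exists>K. \<forall>E. club_in (seg \<sigma>) E \<longrightarrow> (\<exists>\<epsilon>. \<epsilon> \<prec> \<sigma> \<and> thin t \<epsilon> (K \<epsilon>) \<and> K \<epsilon> \<subseteq> E)"
proof -
  define c where "c \<epsilon> = (SOME A. thin t \<epsilon> A)" for \<epsilon>
  have c: "thin t \<epsilon> (c \<epsilon>)" if cf: "cf_is R \<epsilon> t" for \<epsilon>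
  proof -
    have "\<exists>A. thin t \<epsilon> A"
      using thin_exists[OF cf] by blast
    then show ?thesis
      unfolding c_def by (rule someI_ex)
  qed
  have t: "is_cardinal R t" and t_inf: "infinite (seg t)"
    using reg s unfolding cf_is_def succ_seg_def by blast+
  have s_inf: "infinite (seg s)"
    using \<sigma> unfolding succ_seg_def by blast
  define guess where "guess E E' \<longleftrightarrow>
      (\<exists>\<epsilon>. \<epsilon> \<prec> \<sigma> \<and> lp E \<epsilon> \<and> cf_is R \<epsilon> t \<and> proj E (c \<epsilon>) \<subseteq> E')" for E E'
  have "\<exists>E. club_in (seg \<sigma>) E \<and> (\<forall>E'. club_in (seg \<sigma>) E' \<longrightarrow> guess E E')"
  proof (rule ccontr)
    assume "\<not> ?thesis"
    then have "\<forall>E. \<exists>E'. club_in (seg \<sigma>) E \<longrightarrow> club_in (seg \<sigma>) E' \<and> \<not> guess E E'"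
      by blast
    from choice[OF this] obtain Bd where Bd: "\<And>E. club_in (seg \<sigma>) E \<Longrightarrow> club_in (seg \<sigma>) (Bd E)"
        "\<And>E. club_in (seg \<sigma>) E \<Longrightarrow> \<not> guess E (Bd E)"
      by blast
    \<comment> \<open>\<open>E i\<close> is contained in all earlier sets and in the clubs
      \<open>Bd (E j)\<close> that refute them. For i below \<open>s\<close> it is an intersection
      of at most |s| clubs of \<sigma>, hence a club.\<close>
    have "\<exists>E. \<forall>i. E i = {x\<in>seg \<sigma>. \<forall>j\<in>seg i. x \<in> E j \<and> x \<in> Bd (E j)}"
      by (rule wf_recursion) simp
    then obtain E where E: "\<And>i. E i = {x\<in>seg \<sigma>. \<forall>j\<in>seg i. x \<in> E j \<and> x \<in> Bd (E j)}"
      by blast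
    have anti: "E i \<subseteq> E j" if "j \<preceq> i" for i j
    proof (cases "j = i")
      case False
      then have "j \<in> seg i"
        using that by (simp add: ord.le_less)
      then show ?thesis
        by (subst E) blast
    qed simp
    have Bd_sub: "E i \<subseteq> Bd (E j)" if "j \<prec> i" for i j
      by (subst E) (use that in auto)
    have club: "club_in (seg \<sigma>) (E i)" if "i \<prec> s" for i
      using that
    proof (induction i rule: ord.less_induct)
      case (less i)
      define D where "D = (\<lambda>(j, b). if b then E j else Bd (E j))"
      have "E i = {x\<in>seg \<sigma>. \<forall>d\<in>seg i \<times> UNIV. x \<in> D d}"
        by (subst E) (auto simp: D_def split: if_splits)
      moreover have "club_in (seg \<sigma>) {x\<in>seg \<sigma>. \<forall>d\<in>seg i \<times> (UNIV :: bool set). x \<in> D d}"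
      proof (rule club_in_INT[OF \<sigma>])
        show "cle (seg i \<times> (UNIV :: bool set)) (seg s)"
        proof (rule cle_Times[OF s_inf])
          show "cle (seg i) (seg s)"
            using less.prems by (intro cle_subset seg_mono ord.less_imp_le)
          show "cle (UNIV :: bool set) (seg s)"
            by (rule cle_finite[OF _ s_inf]) simp
        qed
        fix d assume "d \<in> seg i \<times> (UNIV :: bool set)"
        then obtain j b where d: "d = (j, b)" "j \<prec> i" by auto
        then have "club_in (seg \<sigma>) (E j)"
          using less.IH less.prems ord.less_trans by blast
        then show "club_in (seg \<sigma>) (D d)"
          unfolding D_def d(1) using Bd(1) by simp
      qed
      ultimately show ?case
        by simp
    qed
    define E0 where "E0 = {x\<in>seg \<sigma>. \<forall>i\<in>seg s. x \<in> E i}"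
    have E0: "club_in (seg \<sigma>) E0"
      unfolding E0_def by (rule club_in_INT[OF \<sigma> cle_refl]) (use club in simp)
    obtain \<xi> where \<xi>: "\<And>i. i \<prec> \<sigma> \<Longrightarrow> \<xi> i \<in> E0" "\<And>i k. i \<prec> \<sigma> \<Longrightarrow> k \<prec> i \<Longrightarrow> \<xi> k \<prec> \<xi> i"
        "\<And>i y. i \<prec> \<sigma> \<Longrightarrow> is_limit R i \<Longrightarrow> y \<prec> \<xi> i \<Longrightarrow> \<exists>k. k \<prec> i \<and> y \<prec> \<xi> k"
    proof (rule normal_function[OF \<sigma> E0, of "\<lambda>_ _. {}"])
      show "{} \<subseteq> seg \<sigma> \<and> cle {} (seg s)"
        by (simp add: cle_finite s_inf)
    qed (use that in auto)
    \<comment> \<open>By continuity this point has cofinality \<theta> and is a limit of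
      \<open>E0\<close>, hence of all the clubs \<open>E i\<close> with i below \<open>s\<close>
      simultaneously.\<close>
    define \<epsilon> where "\<epsilon> = \<xi> t"
    have lim: "is_limit R t"
      by (rule cardinal_limit[OF t t_inf])
    have cof: "\<exists>k. k \<prec> t \<and> y \<prec> \<xi> k" if "y \<prec> \<epsilon>" for y
      using \<xi>(3)[OF t\<sigma> lim] that unfolding \<epsilon>_def by blast
    have inc: "\<xi> k \<prec> \<epsilon>" if "k \<prec> t" for k
      unfolding \<epsilon>_def by (rule \<xi>(2)[OF t\<sigma> that])
    have \<epsilon>\<sigma>: "\<epsilon> \<prec> \<sigma>"
      using \<xi>(1)[OF t\<sigma>] unfolding \<epsilon>_def E0_def by simp
    have cf: "cf_is R \<epsilon> t"
    proof (rule cf_from_map[OF reg, of \<xi>])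
      show "\<xi> i \<prec> \<xi> j" if "i \<prec> j" "j \<prec> t" for i j
        using \<xi>(2) that t\<sigma> ord.less_trans by blast
      show "\<exists>i. i \<prec> t \<and> y \<preceq> \<xi> i" if "y \<prec> \<epsilon>" for y
        using cof[OF that] ord.less_imp_le by blast
    qed (rule inc)
    have "lp E0 \<epsilon>"
      unfolding lp_def
    proof (intro conjI allI impI)
      show "seg \<epsilon> \<noteq> {}"
        using inc limit_nonempty[OF lim] by (metis empty_iff seg_iff)
      fix y assume "y \<prec> \<epsilon>"
      then obtain k where "k \<prec> t" "y \<prec> \<xi> k"
        using cof by blast
      then show "\<exists>e\<in>E0. y \<prec> e \<and> e \<prec> \<epsilon>"
        using \<xi>(1) inc t\<sigma> ord.less_trans by blast
    qed
    then have lpE: "lp (E i) \<epsilon>" if "i \<prec> s" for i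
      by (rule lp_mono) (use that in \<open>auto simp: E0_def\<close>)
    \<comment> \<open>Either the part of \<open>E i\<close> up to \<gamma> becomes empty at some
      stage, and the premise fails from then on, or the weakly decreasing values
      \<open>floor_in (E i) \<gamma>\<close> attain their minimum and stay there; then the value at
      i equals the one at i', which lies in \<open>E i'\<close>.\<close>
    have stab: "\<exists>j. j \<prec> s \<and> (\<forall>i i'. j \<preceq> i \<and> i \<prec> i' \<and> i' \<prec> s \<and> (\<exists>e\<in>E i. e \<preceq> \<gamma>) \<longrightarrow> floor_in (E i) \<gamma> \<in> E i')"
      if \<gamma>: "\<gamma> \<prec> \<sigma>" for \<gamma>
    proof (cases "\<exists>j. j \<prec> s \<and> \<not> (\<exists>e\<in>E j. e \<preceq> \<gamma>)")
      case True
      then show ?thesis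
        using anti by blast
    next
      case False
      obtain j0 where "j0 \<prec> s"
        using s_inf by (metis ex_in_conv finite.emptyI seg_iff)
      define v where "v = least (\<lambda>v. \<exists>j. j \<prec> s \<and> v = floor_in (E j) \<gamma>)"
      have "\<exists>j. j \<prec> s \<and> v = floor_in (E j) \<gamma>"
        unfolding v_def by (rule leastI) (use \<open>j0 \<prec> s\<close> in blast)
      then obtain j where j: "j \<prec> s" "v = floor_in (E j) \<gamma>" by blast
      have const: "floor_in (E i) \<gamma> = v" if i: "j \<preceq> i" "i \<prec> s" for i
      proof (rule ord.order_antisym)
        show "floor_in (E i) \<gamma> \<preceq> v"
          unfolding j(2) by (rule floor_mono[OF anti[OF i(1)]])
        show "v \<preceq> floor_in (E i) \<gamma>"
          unfolding v_def by (rule least_le) (use i(2) in blast)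
      qed
      have "floor_in (E i) \<gamma> \<in> E i'" if i: "j \<preceq> i" "i \<prec> i'" "i' \<prec> s" for i i'
      proof -
        have "floor_in (E i) \<gamma> = floor_in (E i') \<gamma>"
          using const i ord.less_imp_le ord.order_trans ord.less_trans by metis
        moreover obtain e where "e \<in> E i'" "e \<preceq> \<gamma>"
          using False i(3) by blast
        ultimately show ?thesis
          using floor_mem[OF club[OF i(3)] \<gamma>] by simp
      qed
      then show ?thesis
        using j(1) by blast
    qed
    then obtain j where j: "\<And>\<gamma>. \<gamma> \<prec> \<sigma> \<Longrightarrow> j \<gamma> \<prec> s"
        "\<And>\<gamma> i i'. \<gamma> \<prec> \<sigma> \<Longrightarrow> j \<gamma> \<preceq> i \<Longrightarrow> i \<prec> i' \<Longrightarrow> i' \<prec> s \<Longrightarrow> (\<exists>e\<in>E i. e \<preceq> \<gamma>) \<Longrightarrow>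
          floor_in (E i) \<gamma> \<in> E i'"
      by metis
    have c\<sigma>: "\<gamma> \<prec> \<sigma>" if "\<gamma> \<in> c \<epsilon>" for \<gamma>
      using c[OF cf] that ord.less_trans[OF _ \<epsilon>\<sigma>] unfolding thin_def by (metis seg_iff subsetD)
    \<comment> \<open>There are only \<theta> many stabilisation stages, and \<open>s\<close> is
      \<theta>^+, so one stage lies beyond all of them.\<close>
    have "cle (j ` c \<epsilon>) (seg t)"
      by (rule cle_image_le) (use c[OF cf] in \<open>simp add: thin_def ceq_iff\<close>)
    moreover have "j ` c \<epsilon> \<subseteq> seg s"
      using j(1)[OF c\<sigma>] by (simp add: image_subset_iff)
    ultimately obtain i where i: "i \<prec> s" "\<And>\<gamma>. \<gamma> \<in> c \<epsilon> \<Longrightarrow> j \<gamma> \<prec> i"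
      using succ_seg_bounded[OF s, of "j ` c \<epsilon>"] by auto
    have "cle {i} (seg t)"
      by (rule cle_finite[OF _ t_inf]) simp
    then obtain i' where i': "i \<prec> i'" "i' \<prec> s"
      using succ_seg_bounded[OF s, of "{i}"] i(1) by auto
    have "proj (E i) (c \<epsilon>) \<subseteq> E i'"
      unfolding proj_def using j(2)[OF c\<sigma> ord.less_imp_le[OF i(2)] i'] by blast
    also have "\<dots> \<subseteq> Bd (E i)"
      by (rule Bd_sub[OF i'(1)])
    finally show False
      using Bd(2)[OF club[OF i(1)]] \<epsilon>\<sigma> lpE[OF i(1)] cf unfolding guess_def by blast
  qed
  then obtain E where E: "club_in (seg \<sigma>) E"
    "\<And>E'. club_in (seg \<sigma>) E' \<Longrightarrow> guess E E'"
    by blast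
  have "\<exists>\<epsilon>. \<epsilon> \<prec> \<sigma> \<and> thin t \<epsilon> (proj E (c \<epsilon>)) \<and> proj E (c \<epsilon>) \<subseteq> E'" if "club_in (seg \<sigma>) E'" for E'
    using E(2)[OF that] thin_proj[OF E(1) _ _ c reg] unfolding guess_def by blast
  then show ?thesis
    by (intro exI[of _ "\<lambda>\<epsilon>. proj E (c \<epsilon>)"]) blast
qed

subsection \<open>Normal functions\<close>

definition normal_to :: "'a \<Rightarrow> ('a \<Rightarrow> 'a) \<Rightarrow> 'a \<Rightarrow> bool" where
  "normal_to \<sigma> f \<delta> \<longleftrightarrow> (\<forall>i j. i \<prec> j \<and> j \<prec> \<sigma> \<longrightarrow> f i \<prec> f j) \<and> (\<forall>i. i \<prec> \<sigma> \<longrightarrow> f i \<prec> \<delta>) \<and>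
    (\<forall>y. y \<prec> \<delta> \<longrightarrow> (\<exists>i. i \<prec> \<sigma> \<and> y \<prec> f i)) \<and>
    (\<forall>i y. i \<prec> \<sigma> \<and> is_limit R i \<and> y \<prec> f i \<longrightarrow> (\<exists>k. k \<prec> i \<and> y \<prec> f k))"

lemma normal_toD:
  assumes "normal_to \<sigma> f \<delta>"
  shows "\<And>i j. i \<prec> j \<Longrightarrow> j \<prec> \<sigma> \<Longrightarrow> f i \<prec> f j" "\<And>i. i \<prec> \<sigma> \<Longrightarrow> f i \<prec> \<delta>"
    "\<And>y. y \<prec> \<delta> \<Longrightarrow> \<exists>i. i \<prec> \<sigma> \<and> y \<prec> f i"
    "\<And>i y. i \<prec> \<sigma> \<Longrightarrow> is_limit R i \<Longrightarrow> y \<prec> f i \<Longrightarrow> \<exists>k. k \<prec> i \<and> y \<prec> f k"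
  using assms unfolding normal_to_def by blast+

lemma normal_to_limit_le:
  assumes f: "normal_to \<sigma> f \<delta>" and g: "normal_to \<sigma> g \<delta>" and \<alpha>: "is_limit R \<alpha>" "\<alpha> \<prec> \<sigma>"
    and fg: "\<And>k. k \<prec> \<alpha> \<Longrightarrow> \<exists>m. m \<prec> \<alpha> \<and> f k \<preceq> g m"
  shows "f \<alpha> \<preceq> g \<alpha>"
proof (rule ccontr)
  assume "\<not> ?thesis"
  then have "g \<alpha> \<prec> f \<alpha>"
    by (simp add: ord.not_le)
  then obtain k where k: "k \<prec> \<alpha>" "g \<alpha> \<prec> f k"
    using normal_toD(4)[OF f \<alpha>(2,1)] by blast
  obtain m where m: "m \<prec> \<alpha>" "f k \<preceq> g m"
    using fg[OF k(1)] by blast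
  have "g m \<prec> g \<alpha>"
    by (rule normal_toD(1)[OF g m(1) \<alpha>(2)])
  then show False
    using k(2) m(2) by (metis ord.leD ord.less_le_trans ord.less_trans)
qed

text \<open>Alternate between the two functions so that after \<omega> steps their values are
  interleaved; continuity forces equality at the supremum, and likewise at limits of agreement
  points. This allows a function chosen in advance to stand in for one that is built later.\<close>

lemma normal_to_agree:
  assumes \<sigma>: "succ_seg (seg \<sigma>) s" and f: "normal_to \<sigma> f \<delta>" and g: "normal_to \<sigma> g \<delta>"
  shows "club_in (seg \<sigma>) {i. i \<prec> \<sigma> \<and> f i = g i}"
  unfolding club_in_def
proof (intro conjI ballI impI)
  show "{i. i \<prec> \<sigma> \<and> f i = g i} \<subseteq> seg \<sigma>"
    by auto
  fix x assume x: "x \<in> seg \<sigma>"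
  have s_inf: "infinite (seg s)"
    using \<sigma> unfolding succ_seg_def by blast
  have step: "\<exists>z\<in>seg \<sigma>. y \<prec> z \<and> f y \<prec> g z \<and> g y \<prec> f z" if y: "y \<in> seg \<sigma>" for y
  proof -
    have "f y \<prec> \<delta>" "g y \<prec> \<delta>"
      using normal_toD(2)[OF f] normal_toD(2)[OF g] y by simp_all
    then obtain i j where i: "i \<prec> \<sigma>" "f y \<prec> g i" and j: "j \<prec> \<sigma>" "g y \<prec> f j"
      using normal_toD(3)[OF f] normal_toD(3)[OF g] by meson
    have "cle {y, i, j} (seg s)"
      by (rule cle_finite[OF _ s_inf]) simp
    then obtain z where z: "z \<prec> \<sigma>" "y \<prec> z" "i \<prec> z" "j \<prec> z"
      using succ_seg_bounded[OF \<sigma>, of "{y, i, j}"] y i(1) j(1) by auto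
    have "g i \<prec> g z" "f j \<prec> f z"
      using normal_toD(1)[OF f] normal_toD(1)[OF g] z by blast+
    then have "f y \<prec> g z" "g y \<prec> f z"
      using i(2) j(2) ord.less_trans by blast+
    then show ?thesis
      using z by auto
  qed
  have "\<exists>u. \<forall>n. (u n \<in> seg \<sigma> \<and> (n = 0 \<longrightarrow> u n = x)) \<and>
      (u n \<prec> u (Suc n) \<and> f (u n) \<prec> g (u (Suc n)) \<and> g (u n) \<prec> f (u (Suc n)))"
    by (rule dependent_nat_choice) (use x step in \<open>simp_all add: Bex_def\<close>)
  then obtain u :: "nat \<Rightarrow> 'a" where u: "u 0 = x" "\<And>n. u n \<in> seg \<sigma>" "\<And>n. u n \<prec> u (Suc n)"
      "\<And>n. f (u n) \<prec> g (u (Suc n))" "\<And>n. g (u n) \<prec> f (u (Suc n))"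
    by blast
  obtain \<alpha> where \<alpha>: "\<alpha> \<in> seg \<sigma>" "\<And>n. u n \<prec> \<alpha>" "\<And>y. y \<prec> \<alpha> \<Longrightarrow> \<exists>n. y \<prec> u n"
    using omega_sup[OF \<sigma>, of u] u(2,3) by blast
  have \<alpha>\<sigma>: "\<alpha> \<prec> \<sigma>"
    using \<alpha>(1) by simp
  have lim: "is_limit R \<alpha>"
    unfolding is_limit_def using \<alpha>(2,3) by (metis empty_iff seg_iff)
  have fg: "\<exists>m. m \<prec> \<alpha> \<and> f k \<preceq> g m" "\<exists>m. m \<prec> \<alpha> \<and> g k \<preceq> f m" if "k \<prec> \<alpha>" for k
  proof -
    obtain n where n: "k \<prec> u n"
      using \<alpha>(3) \<open>k \<prec> \<alpha>\<close> by blast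
    have "u n \<prec> \<sigma>"
      using u(2) by simp
    then have "f k \<prec> f (u n)" "g k \<prec> g (u n)"
      using normal_toD(1)[OF f n] normal_toD(1)[OF g n] by blast+
    then have "f k \<preceq> g (u (Suc n))" "g k \<preceq> f (u (Suc n))"
      using u(4,5) ord.less_trans ord.less_imp_le by blast+
    then show "\<exists>m. m \<prec> \<alpha> \<and> f k \<preceq> g m" "\<exists>m. m \<prec> \<alpha> \<and> g k \<preceq> f m"
      using \<alpha>(2) by blast+
  qed
  have "f \<alpha> = g \<alpha>"
    using normal_to_limit_le[OF f g lim \<alpha>\<sigma> fg(1)] normal_to_limit_le[OF g f lim \<alpha>\<sigma> fg(2)]
    by (rule ord.order_antisym)
  then show "\<exists>y\<in>{i. i \<prec> \<sigma> \<and> f i = g i}. x \<prec> y"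
    using \<alpha>\<sigma> \<alpha>(2)[of 0] u(1) by auto
next
  fix \<alpha> assume "\<alpha> \<in> seg \<sigma>" and lp: "lp {i. i \<prec> \<sigma> \<and> f i = g i} \<alpha>"
  then have \<alpha>: "\<alpha> \<prec> \<sigma>" by simp
  have lim: "is_limit R \<alpha>"
    using lp unfolding is_limit_def lp_def by (metis seg_iff)
  have fg: "\<exists>m. m \<prec> \<alpha> \<and> f k \<preceq> g m" "\<exists>m. m \<prec> \<alpha> \<and> g k \<preceq> f m" if "k \<prec> \<alpha>" for k
  proof -
    obtain m where m: "f m = g m" "k \<prec> m" "m \<prec> \<alpha>"
      using lp \<open>k \<prec> \<alpha>\<close> unfolding lp_def by blast
    have "m \<prec> \<sigma>"
      using m(3) \<alpha> by (rule ord.less_trans)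
    then have "f k \<prec> f m" "g k \<prec> g m"
      using normal_toD(1)[OF f m(2)] normal_toD(1)[OF g m(2)] by blast+
    then show "\<exists>m. m \<prec> \<alpha> \<and> f k \<preceq> g m" "\<exists>m. m \<prec> \<alpha> \<and> g k \<preceq> f m"
      using m ord.less_imp_le by metis+
  qed
  have "f \<alpha> = g \<alpha>"
    using normal_to_limit_le[OF f g lim \<alpha> fg(1)] normal_to_limit_le[OF g f lim \<alpha> fg(2)]
    by (rule ord.order_antisym)
  then show "\<alpha> \<in> {i. i \<prec> \<sigma> \<and> f i = g i}"
    using \<alpha> by blast
qed

end

section \<open>Families of set-valued functions\<close>

text \<open>By \<open>succ_bound\<close> and \<open>succ_big\<close> the order type of
  \<open>R\<close> is \<lambda>^+. Both alternatives for \<chi> give \<open>c_ne\<close>, which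
  makes the empty set a permitted value of the functions in a family.\<close>

locale succ_card = wo_base R for R :: "'a rel" +
  fixes l t c :: 'a
  assumes l_card: "is_cardinal R l" and l_inf: "infinite (seg l)"
    and succ_bound: "\<And>\<alpha>. cle (seg \<alpha>) (seg l)"
    and succ_big: "\<not> cle (UNIV :: 'a set) (seg l)"
    and t_inf: "infinite (seg t)" and t_reg: "cf_is R t t"
    and c_ne: "seg c \<noteq> {}"
    and c_le_t: "c \<preceq> t" and t_lt_l: "t \<prec> l"
    and t_ne_cf: "\<not> cf_is R l t"
begin

lemma t_card: "is_cardinal R t"
  using t_reg unfolding cf_is_def by blast

lemma U0: "succ_seg UNIV l"
  unfolding succ_seg_def using l_inf succ_bound succ_big by simp

lemma t_sub: "seg t \<subseteq> seg l"
  by (rule seg_mono[OF ord.less_imp_le[OF t_lt_l]])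

lemma t_small: "\<not> cle (seg l) (seg t)"
  using cardinal_less[OF l_card t_lt_l] .

lemma c_small: "cless A (seg c) \<Longrightarrow> cle A (seg t)"
  unfolding cless_iff using cle_total cle_trans cle_subset[OF seg_mono[OF c_le_t]] by blast

lemma cless_c_mono: "cless A (seg c) \<Longrightarrow> cle B A \<Longrightarrow> cless B (seg c)"
  unfolding cless_iff using cle_trans by blast

lemma cless_c_empty: "cless {} (seg c)"
  unfolding cless_iff cle_iff using c_ne by simp

lemma good_family_hit:
  assumes H: "good_family R \<Delta> L t c H" and X: "X \<subseteq> \<Delta>" "ceq X (seg t)" "\<forall>\<xi>\<in>X. g \<xi> \<in> L"
  obtains h where "h \<in> H" "ceq {\<xi>\<in>X. g \<xi> \<in> h \<xi>} (seg t)"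
proof -
  have "\<exists>h\<in>H. ceq {\<xi>\<in>X. g \<xi> \<in> h \<xi>} (seg t)"
    by (rule conjunct2[OF H[unfolded good_family_def], THEN spec[of _ X], THEN spec[of _ g], THEN mp])
      (intro conjI X)
  then show thesis
    using that by blast
qed

text \<open>Diagonalisation: at each \<xi> fewer than \<lambda> members with values of size at most
  \<theta> leave some ordinal below \<lambda> uncovered, and a \<open>g\<close> choosing such
  ordinals is never caught.\<close>

lemma good_lower_bound:
  assumes H: "good_family R \<Delta> (seg l) t c H" and \<Delta>: "seg t \<subseteq> \<Delta>"
  shows "cle (seg l) H"
proof (rule ccontr)
  assume neg: "\<not> cle (seg l) H"
  \<comment> \<open>The disjoint sum is a single infinite set, smaller than \<lambda>, that bounds
    both the number of members and the size of each value.\<close>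
  have small: "\<not> cle (seg l) (H <+> seg t)"
    using neg t_small card_of_Plus_ordLess_infinite[OF l_inf, of H "seg t"]
    unfolding cless_iff[symmetric] cless_def by blast
  have inf: "infinite (H <+> seg t)"
    using t_inf by simp
  have "\<exists>y. y \<prec> l \<and> (\<forall>h\<in>H. y \<notin> h \<xi>)" if "\<xi> \<in> \<Delta>" for \<xi>
  proof (rule ccontr)
    assume "\<not> ?thesis"
    then have "seg l \<subseteq> (\<Union>h\<in>H. h \<xi>)"
      by auto
    moreover have "cle (\<Union>h\<in>H. h \<xi>) (H <+> seg t)"
    proof (rule cle_UN[OF inf])
      show "cle H (H <+> seg t)"
        by (rule cleI[of Inl]) auto
      fix h assume "h \<in> H"
      then have "cle (h \<xi>) (seg t)"
        using H \<open>\<xi> \<in> \<Delta>\<close> c_small unfolding good_family_def by blast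
      moreover have "cle (seg t) (H <+> seg t)"
        by (rule cleI[of Inr]) auto
      ultimately show "cle (h \<xi>) (H <+> seg t)"
        by (rule cle_trans)
    qed
    ultimately show False
      using small cle_subset cle_trans by blast
  qed
  then obtain g where g: "\<And>\<xi>. \<xi> \<in> \<Delta> \<Longrightarrow> g \<xi> \<prec> l \<and> (\<forall>h\<in>H. g \<xi> \<notin> h \<xi>)"
    by metis
  have "ceq (seg t) (seg t)" "\<forall>\<xi>\<in>seg t. g \<xi> \<in> seg l"
    using \<Delta> g unfolding ceq_iff by auto
  then obtain h where h: "h \<in> H" "ceq {\<xi>\<in>seg t. g \<xi> \<in> h \<xi>} (seg t)"
    using good_family_hit[OF H \<Delta>] by blast
  have empty: "{\<xi>\<in>seg t. g \<xi> \<in> h \<xi>} = {}"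
    using g h(1) \<Delta> by blast
  show False
    using h(2)[unfolded empty ceq_iff cle_iff] t_inf by auto
qed

text \<open>As the lower bound is automatic, an indexed family of at most \<lambda> functions is
  enough. Truncating it to \<open>\<Delta>\<close> and \<open>seg l\<close> gives the required
  format and loses no hit.\<close>

lemma m_isI:
  assumes \<Delta>: "seg t \<subseteq> \<Delta>" and I: "cle I (seg l)" and small: "\<And>i \<xi>. i \<in> I \<Longrightarrow> cless (h i \<xi>) (seg c)"
    and hit: "\<And>X g. X \<subseteq> \<Delta> \<Longrightarrow> ceq X (seg t) \<Longrightarrow> (\<And>\<xi>. \<xi> \<in> X \<Longrightarrow> g \<xi> \<prec> l) \<Longrightarrow>
      \<exists>i\<in>I. cle (seg t) {\<xi>\<in>X. g \<xi> \<in> h i \<xi>}"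
  shows "m_is R \<Delta> (seg l) t c (seg l)"
proof -
  define H where "H = (\<lambda>i \<xi>. if \<xi> \<in> \<Delta> then h i \<xi> \<inter> seg l else {}) ` I"
  have good: "good_family R \<Delta> (seg l) t c H"
    unfolding good_family_def
  proof (intro conjI ballI allI impI)
    fix k \<xi> assume "k \<in> H"
    then obtain i where i: "i \<in> I" "k = (\<lambda>\<xi>. if \<xi> \<in> \<Delta> then h i \<xi> \<inter> seg l else {})"
      unfolding H_def by blast
    show "\<xi> \<notin> \<Delta> \<Longrightarrow> k \<xi> = {}"
      using i by simp
    assume "\<xi> \<in> \<Delta>"
    then show "k \<xi> \<subseteq> seg l"
      using i by simp
    have "cle (k \<xi>) (h i \<xi>)"
      by (rule cle_subset) (use i in auto)
    then show "cless (k \<xi>) (seg c)"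
      by (rule cless_c_mono[OF small[OF i(1)]])
  next
    fix X g assume X: "X \<subseteq> \<Delta> \<and> ceq X (seg t) \<and> (\<forall>\<xi>\<in>X. g \<xi> \<in> seg l)"
    then obtain i where i: "i \<in> I" "cle (seg t) {\<xi>\<in>X. g \<xi> \<in> h i \<xi>}"
      using hit[of X g] by auto
    define k where "k = (\<lambda>\<xi>. if \<xi> \<in> \<Delta> then h i \<xi> \<inter> seg l else {})"
    have "{\<xi>\<in>X. g \<xi> \<in> k \<xi>} = {\<xi>\<in>X. g \<xi> \<in> h i \<xi>}"
      unfolding k_def using X by auto
    moreover have "cle {\<xi>\<in>X. g \<xi> \<in> k \<xi>} (seg t)"
      using X cle_trans[OF cle_subset, of "{\<xi>\<in>X. g \<xi> \<in> k \<xi>}" X] unfolding ceq_iff by blast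
    ultimately have "ceq {\<xi>\<in>X. g \<xi> \<in> k \<xi>} (seg t)"
      using i unfolding ceq_iff by simp
    moreover have "k \<in> H"
      unfolding H_def k_def using i by blast
    ultimately show "\<exists>h\<in>H. ceq {\<xi>\<in>X. g \<xi> \<in> h \<xi>} (seg t)"
      by blast
  qed
  have "cle H (seg l)"
    unfolding H_def by (rule cle_image_le[OF I])
  then show ?thesis
    unfolding m_is_def ceq_iff using good good_lower_bound[OF _ \<Delta>] by blast
qed

text \<open>The form in which a family is applied: \<open>X\<close> may have more than \<theta>
  elements, since the hit is obtained on a subset of size \<theta>, and values are small at every
  argument.\<close>

lemma m_isE:
  assumes "m_is R \<Delta> (seg l) t c (seg l)"
  obtains H where "cle H (seg l)" "\<And>h \<xi>. h \<in> H \<Longrightarrow> cless (h \<xi>) (seg c)"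
    "\<And>X g. X \<subseteq> \<Delta> \<Longrightarrow> cle (seg t) X \<Longrightarrow> (\<And>\<xi>. \<xi> \<in> X \<Longrightarrow> g \<xi> \<prec> l) \<Longrightarrow>
      \<exists>h\<in>H. cle (seg t) {\<xi>\<in>X. g \<xi> \<in> h \<xi>}"
proof -
  obtain H where H: "good_family R \<Delta> (seg l) t c H" "ceq H (seg l)"
    using assms unfolding m_is_def by blast
  show thesis
  proof (rule that[of H])
    show "cle H (seg l)"
      using H(2) unfolding ceq_iff by blast
    show "cless (h \<xi>) (seg c)" if "h \<in> H" for h \<xi>
      using H(1) that cless_c_empty unfolding good_family_def by (cases "\<xi> \<in> \<Delta>") auto
    fix X g assume X: "X \<subseteq> \<Delta>" "cle (seg t) X" "\<And>\<xi>. \<xi> \<in> X \<Longrightarrow> g \<xi> \<prec> l"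
    obtain k where k: "inj_on k (seg t)" "k ` seg t \<subseteq> X"
      using X(2) unfolding cle_iff by blast
    have "ceq (k ` seg t) (seg t)"
      unfolding ceq_iff using cle_image cle_inj_image[OF k(1)] by blast
    moreover have "\<forall>\<xi>\<in>k ` seg t. g \<xi> \<in> seg l"
      using k(2) X(3) by (metis seg_iff subsetD)
    ultimately obtain h where h: "h \<in> H" "ceq {\<xi>\<in>k ` seg t. g \<xi> \<in> h \<xi>} (seg t)"
      using good_family_hit[OF H(1) subset_trans[OF k(2) X(1)]] by blast
    have "{\<xi>\<in>k ` seg t. g \<xi> \<in> h \<xi>} \<subseteq> {\<xi>\<in>X. g \<xi> \<in> h \<xi>}"
      using k(2) by blast
    then show "\<exists>h\<in>H. cle (seg t) {\<xi>\<in>X. g \<xi> \<in> h \<xi>}"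
      using h cle_subset cle_trans unfolding ceq_iff by blast
  qed
qed

lemma m_l_imp_m_t:
  assumes "m_is R (seg l) (seg l) t c (seg l)"
  shows "m_is R (seg t) (seg l) t c (seg l)"
proof (rule m_isE[OF assms])
  fix H assume H: "cle H (seg l)" "\<And>h \<xi>. h \<in> H \<Longrightarrow> cless (h \<xi>) (seg c)"
    "\<And>X g. X \<subseteq> seg l \<Longrightarrow> cle (seg t) X \<Longrightarrow> (\<And>\<xi>. \<xi> \<in> X \<Longrightarrow> g \<xi> \<prec> l) \<Longrightarrow>
      \<exists>h\<in>H. cle (seg t) {\<xi>\<in>X. g \<xi> \<in> h \<xi>}"
  show ?thesis
    by (rule m_isI[of _ H "\<lambda>h. h"]) (use H t_sub in \<open>auto simp: ceq_iff\<close>)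
qed

lemma m_t_imp_m_l:
  assumes "m_is R (seg t) (seg l) t c (seg l)"
  shows "m_is R (seg l) (seg l) t c (seg l)"
proof (rule m_isE[OF assms])
  fix H assume H: "cle H (seg l)" "\<And>h \<xi>. h \<in> H \<Longrightarrow> cless (h \<xi>) (seg c)"
    and hit: "\<And>X g. X \<subseteq> seg t \<Longrightarrow> cle (seg t) X \<Longrightarrow> (\<And>\<xi>. \<xi> \<in> X \<Longrightarrow> g \<xi> \<prec> l) \<Longrightarrow>
      \<exists>h\<in>H. cle (seg t) {\<xi>\<in>X. g \<xi> \<in> h \<xi>}"
  obtain pr where pr: "inj_on pr (seg l \<times> seg l)" "pr ` (seg l \<times> seg l) \<subseteq> seg l"
    using cle_Times[OF l_inf cle_refl cle_refl] unfolding cle_iff by blast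
  define Q where "Q \<delta> p \<longleftrightarrow> (\<forall>x. p x \<prec> t) \<and> (\<forall>k. \<exists>y. y \<prec> \<delta> \<and> (\<forall>x. x \<prec> \<delta> \<and> p x = k \<longrightarrow> x \<prec> y))" for \<delta> p
  define p where "p \<delta> = (SOME p. Q \<delta> p)" for \<delta>
  define h' where "h' = (\<lambda>(\<delta>, h) x. {y. y \<prec> l \<and> x \<prec> l \<and> pr (x, y) \<in> h (p \<delta> x)})"
  show ?thesis
  proof (rule m_isI[of _ "seg l \<times> H" h'])
    show "cle (seg l \<times> H) (seg l)"
      by (rule cle_Times) (use l_inf H in auto)
    fix i x assume "i \<in> seg l \<times> H"
    then obtain \<delta> h where i: "i = (\<delta>, h)" "h \<in> H" by blast
    have "cle (h' i x) (h (p \<delta> x))"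
      by (rule cleI[of "\<lambda>y. pr (x, y)"]) (use pr(1) in \<open>auto simp: i h'_def inj_on_def\<close>)
    then show "cless (h' i x) (seg c)"
      by (rule cless_c_mono[OF H(2)[OF i(2)]])
  next
    fix X g assume X: "X \<subseteq> seg l" "ceq X (seg t)" and g: "\<And>\<xi>. \<xi> \<in> X \<Longrightarrow> g \<xi> \<prec> l"
    have "x \<prec> l" if "x \<in> X" for x
      using subsetD[OF X(1) that] by simp
    then obtain i where i: "i \<prec> l" "cle (seg t) {y\<in>X. y \<prec> i}"
      using small_target[OF t_reg l_card l_inf t_ne_cf X(2), of "\<lambda>x. x"] by blast
    \<comment> \<open>Minimality is used twice: it makes the part of \<open>X\<close> below \<delta>
      thin, which yields a map satisfying \<open>Q\<close>, and it rules out \<theta> many elements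
      of \<open>X\<close> in one bounded fibre.\<close>
    define \<delta> where "\<delta> = least (\<lambda>\<delta>. cle (seg t) (X \<inter> seg \<delta>))"
    have "{y\<in>X. y \<prec> i} = X \<inter> seg i"
      by auto
    then have i2: "cle (seg t) (X \<inter> seg i)"
      using i(2) by simp
    have "\<delta> \<preceq> i"
      unfolding \<delta>_def by (rule least_le) (rule i2)
    then have \<delta>l: "\<delta> \<prec> l"
      using i(1) ord.le_less_trans by blast
    define Y where "Y = X \<inter> seg \<delta>"
    have Y1: "cle (seg t) Y"
      unfolding Y_def \<delta>_def by (rule leastI[of "\<lambda>\<delta>. cle (seg t) (X \<inter> seg \<delta>)" i]) (rule i2)
    have Y2: "cle Y (seg t)"
      using X(2) cle_trans[OF cle_subset, of Y X "seg t"] unfolding ceq_iff Y_def by blast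
    have small: "\<not> cle (seg t) (X \<inter> seg y)" if "y \<prec> \<delta>" for y
      using not_less_least[OF that[unfolded \<delta>_def]] .
    have thin: "thin t \<delta> Y"
      unfolding thin_def
    proof (intro conjI allI impI)
      show "Y \<subseteq> seg \<delta>" "ceq Y (seg t)"
        using Y1 Y2 unfolding Y_def ceq_iff by auto
      fix y assume y: "y \<prec> \<delta>"
      have "Y \<inter> seg y \<subseteq> X \<inter> seg y"
        unfolding Y_def by blast
      then show "\<not> cle (seg t) (Y \<inter> seg y)"
        using small[OF y] cle_subset cle_trans by blast
    qed
    obtain \<phi> where \<phi>: "\<phi> ` seg t = Y" "\<And>i j. i \<prec> j \<Longrightarrow> j \<prec> t \<Longrightarrow> \<phi> i \<prec> \<phi> j"
      using thin_map[OF thin t_card] by blast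
    have cof: "\<exists>k. k \<prec> t \<and> x \<preceq> \<phi> k" if "x \<prec> \<delta>" for x
      using thin_cofinal[OF thin order_refl Y1 that] unfolding \<phi>(1)[symmetric] by auto
    obtain t0 where t0: "t0 \<prec> t"
      using t_inf by (metis finite.emptyI ex_in_conv seg_iff)
    \<comment> \<open>The first index at which the enumeration of \<open>Y\<close> reaches x; the
      next value of the enumeration bounds the fibre. Outside \<delta> the value \<open>t0\<close>
      keeps the map inside \<theta>.\<close>
    define p0 where "p0 x = (if x \<prec> \<delta> then least (\<lambda>k. k \<prec> t \<and> x \<preceq> \<phi> k) else t0)" for x
    have p0: "p0 x \<prec> t \<and> (x \<prec> \<delta> \<longrightarrow> x \<preceq> \<phi> (p0 x))" for x
    proof (cases "x \<prec> \<delta>")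
      case True
      then obtain k where "k \<prec> t \<and> x \<preceq> \<phi> k" using cof by blast
      then show ?thesis
        using leastI[of "\<lambda>k. k \<prec> t \<and> x \<preceq> \<phi> k"] True unfolding p0_def by simp
    qed (simp add: p0_def t0)
    have "Q \<delta> p0"
      unfolding Q_def
    proof (intro conjI allI)
      show "p0 x \<prec> t" for x using p0 by blast
      fix k
      show "\<exists>y. y \<prec> \<delta> \<and> (\<forall>x. x \<prec> \<delta> \<and> p0 x = k \<longrightarrow> x \<prec> y)"
      proof (cases "k \<prec> t")
        case True
        then obtain k' where k': "k \<prec> k'" "k' \<prec> t"
          using limitD[OF cardinal_limit[OF t_card t_inf]] by blast
        have "\<phi> k' \<prec> \<delta>"
          using \<phi>(1) k'(2) unfolding Y_def by (metis IntD2 imageI seg_iff)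
        moreover have "x \<prec> \<phi> k'" if "x \<prec> \<delta> \<and> p0 x = k" for x
          using p0[of x] that \<phi>(2)[OF k'] ord.le_less_trans by blast
        ultimately show ?thesis by blast
      next
        case False
        have "\<phi> t0 \<prec> \<delta>"
          using \<phi>(1) t0 unfolding Y_def by (metis IntD2 imageI seg_iff)
        then show ?thesis
          using p0 False by blast
      qed
    qed
    then have Q: "Q \<delta> (p \<delta>)"
      unfolding p_def by (rule someI[of "Q \<delta>"])
    have big: "cle (seg t) (p \<delta> ` Y)"
    proof (rule ccontr)
      assume "\<not> ?thesis"
      then obtain z where z: "z \<in> p \<delta> ` Y" "cle (seg t) {y\<in>Y. p \<delta> y = z}"
        using pigeonhole[OF t_reg Y1] by blast
      obtain y where y: "y \<prec> \<delta>" "\<And>x. x \<prec> \<delta> \<Longrightarrow> p \<delta> x = z \<Longrightarrow> x \<prec> y"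
        using Q unfolding Q_def by blast
      have "{y\<in>Y. p \<delta> y = z} \<subseteq> X \<inter> seg y"
        using y unfolding Y_def by auto
      then show False
        using small[OF y(1)] z(2) cle_subset cle_trans by blast
    qed
    obtain Z where Z: "Z \<subseteq> Y" "inj_on (p \<delta>) Z" "p \<delta> ` Z = p \<delta> ` Y"
      using exists_section[of Y "p \<delta>"] by blast
    define q where "q = the_inv_into Z (p \<delta>)"
    have q: "q (p \<delta> x) = x" if "x \<in> Z" for x
      unfolding q_def using the_inv_into_f_f[OF Z(2) that] .
    have "\<exists>h\<in>H. cle (seg t) {\<xi>\<in>p \<delta> ` Z. pr (q \<xi>, g (q \<xi>)) \<in> h \<xi>}"
    proof (rule hit)
      show "p \<delta> ` Z \<subseteq> seg t" using Q unfolding Q_def by auto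
      show "cle (seg t) (p \<delta> ` Z)" using big Z by simp
      fix \<xi> assume "\<xi> \<in> p \<delta> ` Z"
      then have "q \<xi> \<in> X" using q Z(1) unfolding Y_def by auto
      then have "(q \<xi>, g (q \<xi>)) \<in> seg l \<times> seg l" using X(1) g by auto
      then show "pr (q \<xi>, g (q \<xi>)) \<prec> l" using pr(2) by (metis image_subset_iff seg_iff)
    qed
    then obtain h where h: "h \<in> H" "cle (seg t) {\<xi>\<in>p \<delta> ` Z. pr (q \<xi>, g (q \<xi>)) \<in> h \<xi>}"
      by blast
    have "{\<xi>\<in>p \<delta> ` Z. pr (q \<xi>, g (q \<xi>)) \<in> h \<xi>} \<subseteq> p \<delta> ` {x\<in>X. g x \<in> h' (\<delta>, h) x}"
    proof
      fix \<xi> assume "\<xi> \<in> {\<xi>\<in>p \<delta> ` Z. pr (q \<xi>, g (q \<xi>)) \<in> h \<xi>}"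
      then obtain x where x: "x \<in> Z" "\<xi> = p \<delta> x" "pr (x, g x) \<in> h \<xi>"
        using q by auto
      then have "x \<in> X" using Z(1) unfolding Y_def by blast
      then have "g x \<in> h' (\<delta>, h) x"
        unfolding h'_def using x X(1) g by auto
      then show "\<xi> \<in> p \<delta> ` {x\<in>X. g x \<in> h' (\<delta>, h) x}"
        using x \<open>x \<in> X\<close> by blast
    qed
    then have "cle (seg t) {x\<in>X. g x \<in> h' (\<delta>, h) x}"
      by (rule cle_trans[OF h(2) cle_surj])
    then show "\<exists>i\<in>seg l \<times> H. cle (seg t) {x\<in>X. g x \<in> h' i x}"
      using h(1) \<delta>l by (intro bexI[of _ "(\<delta>, h)"]) auto
  qed (rule t_sub)
qed

text \<open>Beyond \<open>l\<close>, functions into \<open>l\<close> can be made regressive, and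
  ordinals below \<open>l\<close> are legitimate indices of guessing functions.\<close>

lemma club_tail:
  assumes "club R C"
  shows "club R {x\<in>C. l \<prec> x}"
  unfolding club_UNIV club_in_def
proof (intro conjI ballI impI)
  have C: "\<And>x. \<exists>y\<in>C. x \<prec> y" "\<And>\<alpha>. lp C \<alpha> \<Longrightarrow> \<alpha> \<in> C"
    using assms unfolding club_UNIV club_in_def by blast+
  show "\<exists>y\<in>{x\<in>C. l \<prec> x}. x \<prec> y" for x
  proof -
    obtain y where "y \<in> C" "l \<prec> y" using C(1) by blast
    obtain z where "z \<in> C" "x \<prec> z" using C(1) by blast
    show ?thesis
      using \<open>y \<in> C\<close> \<open>l \<prec> y\<close> \<open>z \<in> C\<close> \<open>x \<prec> z\<close> ord.less_trans ord.linear ord.less_le_trans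
      by (metis (mono_tags, lifting) mem_Collect_eq)
  qed
  fix \<alpha> assume \<alpha>: "lp {x\<in>C. l \<prec> x} \<alpha>"
  then have "\<alpha> \<in> C"
    using C(2) lp_mono[of "{x\<in>C. l \<prec> x}" \<alpha> C] by blast
  obtain y where "y \<prec> \<alpha>"
    using \<alpha> unfolding lp_def by (metis ex_in_conv seg_iff)
  then obtain e where "l \<prec> e" "e \<prec> \<alpha>"
    using \<alpha> unfolding lp_def by blast
  then show "\<alpha> \<in> {x\<in>C. l \<prec> x}"
    using \<open>\<alpha> \<in> C\<close> ord.less_trans by blast
qed simp

lemma J_stationary_imp_m_t:
  assumes J: "S \<in> J_ideal R c" and st: "stationary R S" and SE: "S \<subseteq> E_cof R t"
  shows "m_is R (seg t) (seg l) t c (seg l)"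
proof -
  obtain C F where C: "club R C" and F: "\<And>i \<beta>. cless (F i \<beta>) (seg c)"
    and CF: "\<And>\<alpha> f B. \<alpha> \<in> S \<inter> C \<Longrightarrow> regressive_on R \<alpha> f \<Longrightarrow> cofinal_in R B \<alpha> \<Longrightarrow>
          \<exists>i\<in>seg \<alpha>. sup_is R {\<beta>\<in>B. f \<beta> \<in> F i \<beta>} \<alpha>"
    using J unfolding J_ideal_def by blast
  obtain \<alpha> where \<alpha>: "\<alpha> \<in> S" "\<alpha> \<in> C" "l \<prec> \<alpha>"
    using st club_tail[OF C] unfolding stationary_def by blast
  have cf: "cf_is R \<alpha> t"
    using \<alpha>(1) SE unfolding E_cof_def by blast
  obtain A where A: "thin t \<alpha> A"
    using thin_exists[OF cf] by blast
  obtain \<phi> where \<phi>: "\<phi> ` seg t = A" "\<And>i j. i \<prec> j \<Longrightarrow> j \<prec> t \<Longrightarrow> \<phi> i \<prec> \<phi> j"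
    using thin_map[OF A t_card] by blast
  have inj: "inj_on \<phi> (seg t)"
    by (rule inj_onI) (metis \<phi>(2) ord.less_irrefl ord.linorder_cases seg_iff)
  show ?thesis
  proof (rule m_isI[of _ "seg \<alpha>" "\<lambda>i \<xi>. F i (\<phi> \<xi>)"])
    show "cle (seg \<alpha>) (seg l)" by (rule succ_bound)
    show "cless (F i (\<phi> \<xi>)) (seg c)" for i \<xi> by (rule F)
    fix X g assume X: "X \<subseteq> seg t" "ceq X (seg t)" and g: "\<And>\<xi>. \<xi> \<in> X \<Longrightarrow> g \<xi> \<prec> l"
    have XA: "\<phi> ` X \<subseteq> A"
      using \<phi>(1) X(1) by blast
    have "cle X (\<phi> ` X)"
      by (rule cle_inj_image) (rule inj_on_subset[OF inj X(1)])
    then have "cle (seg t) (\<phi> ` X)"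
      using X(2) cle_trans unfolding ceq_iff by blast
    note cof = thin_cofinal[OF A XA this]
    have X\<alpha>: "b \<prec> \<alpha>" if "b \<in> \<phi> ` X" for b
      using subsetD[OF XA that] A unfolding thin_def by (metis seg_iff subsetD)
    \<comment> \<open>From \<open>l\<close> on, values of \<open>g\<close> are below their argument.
      Elsewhere the least ordinal serves as a regressive default.\<close>
    define f where "f b = (if b \<in> \<phi> ` X \<and> l \<preceq> b then g (the_inv_into (seg t) \<phi> b) else least (\<lambda>_. True))" for b
    have "regressive_on R \<alpha> f"
      unfolding regressive_on_def
    proof (intro ballI impI)
      fix b assume "seg b \<noteq> {}"
      show "f b \<prec> b"
      proof (cases "b \<in> \<phi> ` X \<and> l \<preceq> b")
        case True
        then obtain x where x: "x \<in> X" "b = \<phi> x" by blast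
        then have "f b = g x"
          unfolding f_def using True the_inv_into_f_f[OF inj, of x] X(1) by auto
        then show ?thesis
          using g[OF x(1)] True ord.less_le_trans by metis
      next
        case False
        then have "f b = least (\<lambda>_. True)" unfolding f_def by meson
        moreover obtain y where "y \<prec> b" using \<open>seg b \<noteq> {}\<close> by auto
        ultimately show ?thesis
          using least_le[of "\<lambda>_. True" y] ord.le_less_trans by auto
      qed
    qed
    moreover have "cofinal_in R (\<phi> ` X) \<alpha>"
      by (rule cofinalI[OF X\<alpha> cof])
    ultimately obtain i where i: "i \<in> seg \<alpha>" "sup_is R {b\<in>\<phi> ` X. f b \<in> F i b} \<alpha>"
      using CF[of \<alpha> f "\<phi> ` X"] \<alpha> by blast
    have sup: "\<And>y. y \<prec> \<alpha> \<Longrightarrow> \<exists>b\<in>{b\<in>\<phi> ` X. f b \<in> F i b}. y \<prec> b"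
      using i(2) unfolding sup_is_def by simp
    \<comment> \<open>Hits below \<open>l\<close> concern only the default value. Discarding them
      keeps the set cofinal because l lies below \<alpha>, and cf(\<alpha>) = \<theta> then leaves
      \<theta> many hits.\<close>
    have "cofinal_in R {b\<in>\<phi> ` X. f b \<in> F i b \<and> l \<preceq> b} \<alpha>"
    proof (rule cofinalI)
      show "b \<prec> \<alpha>" if "b \<in> {b\<in>\<phi> ` X. f b \<in> F i b \<and> l \<preceq> b}" for b
        using that X\<alpha> by blast
      fix y assume y: "y \<prec> \<alpha>"
      define y' where "y' = (if l \<prec> y then y else l)"
      have "y' \<prec> \<alpha>" "y \<preceq> y'" "l \<preceq> y'"
        unfolding y'_def using y \<alpha>(3) by (auto simp: ord.le_less ord.not_less)
      moreover obtain b where "b \<in> \<phi> ` X" "f b \<in> F i b" "y' \<prec> b"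
        using sup[OF \<open>y' \<prec> \<alpha>\<close>] by blast
      ultimately have "y \<preceq> b" "l \<preceq> b"
        using ord.less_imp_le ord.order_trans by blast+
      then show "\<exists>b\<in>{b\<in>\<phi> ` X. f b \<in> F i b \<and> l \<preceq> b}. y \<preceq> b"
        using \<open>b \<in> \<phi> ` X\<close> \<open>f b \<in> F i b\<close> by blast
    qed
    then have "cle (seg t) {b\<in>\<phi> ` X. f b \<in> F i b \<and> l \<preceq> b}"
      using cf unfolding cf_is_def by blast
    moreover have "{b\<in>\<phi> ` X. f b \<in> F i b \<and> l \<preceq> b} \<subseteq> \<phi> ` {\<xi>\<in>X. g \<xi> \<in> F i (\<phi> \<xi>)}"
    proof
      fix b assume b: "b \<in> {b\<in>\<phi> ` X. f b \<in> F i b \<and> l \<preceq> b}"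
      then obtain x where x: "x \<in> X" "b = \<phi> x" by blast
      then have "f b = g x"
        unfolding f_def using b the_inv_into_f_f[OF inj, of x] X(1) by auto
      then show "b \<in> \<phi> ` {\<xi>\<in>X. g \<xi> \<in> F i (\<phi> \<xi>)}"
        using x b by auto
    qed
    ultimately have "cle (seg t) {\<xi>\<in>X. g \<xi> \<in> F i (\<phi> \<xi>)}"
      by (rule cle_trans[OF _ cle_surj])
    then show "\<exists>i\<in>seg \<alpha>. cle (seg t) {\<xi>\<in>X. g \<xi> \<in> F i (\<phi> \<xi>)}"
      using i(1) by blast
  qed simp
qed

section \<open>Ranks and the approachability ideal\<close>

text \<open>The rank of the wellfounded relation given by \<open>G\<close>. It stays within
  \<lambda>^+ because each \<open>G x\<close> has at most \<lambda> elements and \<lambda>^+ is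
  regular; the second clause is the minimality of the rank.\<close>

lemma rank_exists:
  assumes G: "\<And>x. G x \<subseteq> seg x"
  shows "\<exists>rk. \<forall>x. (\<forall>z\<in>G x. rk z \<prec> rk x) \<and> (\<forall>y. y \<prec> rk x \<longrightarrow> (\<exists>z\<in>G x. y \<preceq> rk z))"
proof -
  have cong: "least (\<lambda>y. \<forall>z\<in>G x. f z \<prec> y) = least (\<lambda>y. \<forall>z\<in>G x. g z \<prec> y)"
    if "\<And>y. y \<prec> x \<Longrightarrow> f y = g y" for f g :: "'a \<Rightarrow> 'a" and x
  proof -
    have "f z = g z" if "z \<in> G x" for z
      using subsetD[OF G that] \<open>\<And>y. y \<prec> x \<Longrightarrow> f y = g y\<close> by simp
    then show ?thesis
      by simp
  qed
  have "\<exists>rk. \<forall>x. rk x = least (\<lambda>y. \<forall>z\<in>G x. rk z \<prec> y)"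
    by (rule wf_recursion[of "\<lambda>f x. least (\<lambda>y. \<forall>z\<in>G x. f z \<prec> y)"]) (rule cong)
  then obtain rk where rk: "\<And>x. rk x = least (\<lambda>y. \<forall>z\<in>G x. rk z \<prec> y)"
    by blast
  have 1: "\<forall>z\<in>G x. rk z \<prec> rk x" for x
  proof -
    have "cle (rk ` G x) (seg l)"
      by (rule cle_image_le) (rule cle_trans[OF cle_subset[OF G] succ_bound])
    then obtain y where "\<forall>z\<in>G x. rk z \<prec> y"
      using succ_seg_bounded[OF U0, of "rk ` G x"] by blast
    then show ?thesis
      unfolding rk[of x] by (rule leastI)
  qed
  have 2: "\<exists>z\<in>G x. y \<preceq> rk z" if "y \<prec> rk x" for x y
    using not_less_least[OF that[unfolded rk[of x]]] by (auto simp: ord.not_less)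
  show ?thesis
    using 1 2 by blast
qed

text \<open>Ranks have no gaps: every ordinal below \<open>rk x\<close> is the rank of something
  reached from x by finitely many steps down \<open>G\<close>. At most |m| elements are reached, and
  |m| < \<lambda>.\<close>

lemma rank_below:
  assumes G: "\<And>x. cle (G x) (seg m)" and m: "infinite (seg m)" "m \<prec> l"
    and rk: "\<And>x y. y \<prec> rk x \<Longrightarrow> \<exists>z\<in>G x. y \<preceq> rk z" and dec: "\<And>x. G x \<subseteq> seg x"
  shows "rk x \<prec> l"
proof (rule ccontr)
  assume big: "\<not> rk x \<prec> l"
  define it where "it n = ((\<lambda>W x. \<Union>z\<in>G x. W z) ^^ n) (\<lambda>x. {x})" for n
  have it0: "it 0 x = {x}" and itS: "it (Suc n) x = (\<Union>z\<in>G x. it n z)" for n x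
    unfolding it_def by simp_all
  have "cle (it n x) (seg m)" for n
  proof (induction n arbitrary: x)
    case 0 then show ?case
      unfolding it0 using m(1) by (intro cle_finite) auto
  next
    case (Suc n) then show ?case
      unfolding itS using m(1) G by (intro cle_UN) auto
  qed
  then have small: "cle (\<Union>n. it n x) (seg m)"
    by (intro cle_UN m(1) cle_nat)
  have "seg (rk x) \<subseteq> rk ` (\<Union>n. it n x)" for x
  proof (induction x rule: ord.less_induct)
    case (less x)
    show ?case
    proof
      fix y assume "y \<in> seg (rk x)"
      then obtain z where z: "z \<in> G x" "y \<preceq> rk z"
        using rk by auto
      show "y \<in> rk ` (\<Union>n. it n x)"
      proof (cases "y = rk z")
        case True
        have "z \<in> it (Suc 0) x"
          unfolding itS it0 using z by blast
        then show ?thesis using True by blast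
      next
        case False
        then have "y \<in> seg (rk z)"
          using z(2) by (simp add: ord.le_less)
        moreover have "z \<prec> x"
          using subsetD[OF dec z(1)] by simp
        ultimately obtain n w where w: "y = rk w" "w \<in> it n z"
          using less.IH by blast
        then have "w \<in> it (Suc n) x"
          unfolding itS using z(1) by blast
        then show ?thesis
          using w(1) by blast
      qed
    qed
  qed
  then have "cle (seg (rk x)) (seg m)"
    by (rule cle_trans[OF cle_surj small])
  moreover have "seg l \<subseteq> seg (rk x)"
    using big by (intro seg_mono) (simp add: ord.not_less)
  ultimately have "cle (seg l) (seg m)"
    by (rule cle_trans[OF cle_subset, rotated])
  then show False
    using cardinal_less[OF l_card m(2)] by blast
qed

text \<open>The second disjunct in \<open>G\<close> makes all elements of an initial segment of the approaching set predecessors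
  of every ordinal above its index that codes this index by an ordinal below \<open>i\<close>.  Hence the rank strictly increases
  along many elements of \<open>B\<close>.\<close>

lemma m_l_imp_I_sub_J:
  assumes m: "m_is R (seg l) (seg l) t c (seg l)" and SI: "S \<in> I_ideal R" and SE: "S \<subseteq> E_cof R t"
  shows "S \<in> J_ideal R c"
proof (rule m_isE[OF m])
  fix H assume H: "cle H (seg l)" "\<And>h \<xi>. h \<in> H \<Longrightarrow> cless (h \<xi>) (seg c)"
    and hit: "\<And>X g. X \<subseteq> seg l \<Longrightarrow> cle (seg t) X \<Longrightarrow> (\<And>\<xi>. \<xi> \<in> X \<Longrightarrow> g \<xi> \<prec> l) \<Longrightarrow>
      \<exists>h\<in>H. cle (seg t) {\<xi>\<in>X. g \<xi> \<in> h \<xi>}"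
  obtain a C where C: "club R C"
    and aC: "\<And>\<alpha>. \<alpha> \<in> S \<inter> C \<Longrightarrow> \<exists>A. cofinal_in R A \<alpha> \<and>
          (\<exists>t. cf_is R \<alpha> t \<and> (Restr R A, Restr R (seg t)) \<in> ordIso) \<and>
          (\<forall>\<gamma>\<in>seg \<alpha>. \<exists>\<beta>\<in>seg \<alpha>. A \<inter> seg \<gamma> = a \<beta>)"
    using SI unfolding I_ideal_def by blast
  have "\<forall>b. \<exists>e. inj_on e (seg b) \<and> e ` seg b \<subseteq> seg l"
    using succ_bound unfolding cle_iff by blast
  then obtain e where e: "\<And>b. inj_on (e b) (seg b)" "\<And>b x. x \<prec> b \<Longrightarrow> e b x \<prec> l"
    by (metis image_subset_iff seg_iff)
  define G where "G i b = {x. x \<prec> b \<and> (e b x \<prec> i \<or>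
      (\<exists>\<beta>. \<beta> \<prec> b \<and> e b \<beta> \<prec> i \<and> cle (a \<beta>) (seg t) \<and> x \<in> a \<beta>))}" for i b
  have G_sub: "G i b \<subseteq> seg b" for i b
    unfolding G_def by auto
  have "\<forall>i. \<exists>rk. \<forall>x. (\<forall>z\<in>G i x. rk z \<prec> rk x) \<and> (\<forall>y. y \<prec> rk x \<longrightarrow> (\<exists>z\<in>G i x. y \<preceq> rk z))"
    by (intro allI rank_exists G_sub)
  from choice[OF this] obtain rk where "\<forall>i x. (\<forall>z\<in>G i x. rk i z \<prec> rk i x) \<and>
      (\<forall>y. y \<prec> rk i x \<longrightarrow> (\<exists>z\<in>G i x. y \<preceq> rk i z))"
    by (elim exE)
  then have rk: "\<And>i x z. z \<in> G i x \<Longrightarrow> rk i z \<prec> rk i x"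
      "\<And>i x y. y \<prec> rk i x \<Longrightarrow> \<exists>z\<in>G i x. y \<preceq> rk i z"
    by blast+
  have rk_l: "rk i x \<prec> l" if i: "i \<prec> l" for i x
  proof -
    \<comment> \<open>The larger of i and \<theta>: an infinite size below \<lambda> that bounds the
      elements coded below i as well as a union of that many sets \<open>a \<beta>\<close> of size
      at most \<theta>.\<close>
    define m where "m = (if t \<prec> i then i else t)"
    have m: "m \<prec> l" "seg i \<subseteq> seg m" "seg t \<subseteq> seg m"
      unfolding m_def using i t_lt_l seg_mono ord.less_imp_le ord.not_less by auto
    have inf: "infinite (seg m)"
      using t_inf m(3) finite_subset by blast
    have small: "cle {x. x \<prec> b \<and> e b x \<prec> i} (seg m)" for b
      by (rule cle_trans[OF cleI[of "e b" _ "seg i"] cle_subset[OF m(2)]])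
        (use e(1) in \<open>auto simp: inj_on_def\<close>)
    have "cle (G i b) (seg m)" for b
    proof -
      have "cle (\<Union>\<beta>\<in>{\<beta>. \<beta> \<prec> b \<and> e b \<beta> \<prec> i \<and> cle (a \<beta>) (seg t)}. a \<beta>) (seg m)"
      proof (rule cle_UN[OF inf])
        show "cle {\<beta>. \<beta> \<prec> b \<and> e b \<beta> \<prec> i \<and> cle (a \<beta>) (seg t)} (seg m)"
          by (rule cle_trans[OF cle_subset small[of b]]) blast
      qed (use cle_trans[OF _ cle_subset[OF m(3)]] in blast)
      moreover have "G i b \<subseteq> {x. x \<prec> b \<and> e b x \<prec> i} \<union>
          (\<Union>\<beta>\<in>{\<beta>. \<beta> \<prec> b \<and> e b \<beta> \<prec> i \<and> cle (a \<beta>) (seg t)}. a \<beta>)"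
        unfolding G_def by blast
      ultimately show ?thesis
        using cle_trans[OF cle_subset cle_Un[OF inf small]] by blast
    qed
    then show ?thesis
      by (rule rank_below[OF _ inf m(1) rk(2) G_sub])
  qed
  obtain enc where enc: "inj_on enc (seg l \<times> H)" "enc ` (seg l \<times> H) \<subseteq> seg l"
    using cle_Times[OF l_inf cle_refl H(1)] unfolding cle_iff by blast
  \<comment> \<open>A member of the family is evaluated at the rank of b, and its guesses are
    decoded by \<open>e b\<close>. Since \<open>enc\<close> is injective, j determines at most one
    pair (i, h), so the set is no larger than \<open>h (rk i b)\<close>.\<close>
  define F where "F j b = {y. y \<prec> b \<and> (\<exists>i h. i \<prec> l \<and> h \<in> H \<and> enc (i, h) = j \<and> e b y \<in> h (rk i b))}" for j b
  have F_small: "cless (F j b) (seg c)" for j b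
  proof (cases "\<exists>i h. i \<prec> l \<and> h \<in> H \<and> enc (i, h) = j")
    case True
    then obtain i h where ih: "i \<prec> l" "h \<in> H" "enc (i, h) = j" by blast
    have "i' = i \<and> h' = h" if "i' \<prec> l" "h' \<in> H" "enc (i', h') = j" for i' h'
      using inj_onD[OF enc(1), of "(i', h')" "(i, h)"] that ih by simp
    then have "F j b \<subseteq> {y. y \<prec> b \<and> e b y \<in> h (rk i b)}"
      unfolding F_def by blast
    moreover have "cle {y. y \<prec> b \<and> e b y \<in> h (rk i b)} (h (rk i b))"
      by (rule cleI[of "e b"]) (use e(1) in \<open>auto simp: inj_on_def\<close>)
    ultimately have "cle (F j b) (h (rk i b))"
      using cle_trans[OF cle_subset] by blast
    then show ?thesis
      by (rule cless_c_mono[OF H(2)[OF ih(2)]])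
  next
    case False
    then have "F j b = {}"
      unfolding F_def by blast
    then show ?thesis
      using cless_c_empty by simp
  qed
  have main: "\<exists>j\<in>seg \<alpha>. sup_is R {\<beta>\<in>B. f \<beta> \<in> F j \<beta>} \<alpha>"
    if \<alpha>: "\<alpha> \<in> S" "\<alpha> \<in> C" "l \<prec> \<alpha>" and f: "regressive_on R \<alpha> f" and B: "cofinal_in R B \<alpha>" for \<alpha> f B
  proof -
    have cf: "cf_is R \<alpha> t"
      using \<alpha>(1) SE unfolding E_cof_def by blast
    have lim: "is_limit R \<alpha>"
      by (rule cf_limit[OF cf t_inf])
    obtain A t' where A: "cofinal_in R A \<alpha>" "cf_is R \<alpha> t'" "(Restr R A, Restr R (seg t')) \<in> ordIso"
        "\<forall>\<gamma>\<in>seg \<alpha>. \<exists>\<beta>\<in>seg \<alpha>. A \<inter> seg \<gamma> = a \<beta>"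
      using aC[of \<alpha>] \<alpha> by blast
    have "t' = t"
      by (rule cf_unique[OF A(2) cf])
    then have thin: "thin t \<alpha> A"
      using thin_if_ordIso[OF _ A(1) t_card] A(3) by blast
    then have ceqA: "ceq A (seg t)"
      unfolding thin_def by blast
    have A_below: "\<And>\<gamma>. \<gamma> \<in> A \<Longrightarrow> \<gamma> \<prec> \<alpha>" and B_below: "\<And>b. b \<in> B \<Longrightarrow> b \<prec> \<alpha>"
      using cofinal_below A(1) B by blast+
    have above: "\<exists>b\<in>X. x \<prec> b \<and> y \<prec> b" if "cofinal_in R X \<alpha>" "x \<prec> \<alpha>" "y \<prec> \<alpha>" for X x y
    proof -
      define z where "z = (if x \<prec> y then y else x)"
      have z: "z \<prec> \<alpha>" "x \<preceq> z" "y \<preceq> z"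
        unfolding z_def using that ord.less_imp_le ord.not_less by auto
      obtain z' where "z \<prec> z'" "z' \<prec> \<alpha>"
        using limitD[OF lim z(1)] by blast
      moreover obtain b where "b \<in> X" "z' \<preceq> b"
        using cofinalD[OF \<open>cofinal_in R X \<alpha>\<close> \<open>z' \<prec> \<alpha>\<close>] by blast
      ultimately show ?thesis
        using z ord.le_less_trans ord.less_le_trans by blast
    qed
    have "\<forall>\<gamma>. \<exists>\<beta>. \<gamma> \<in> A \<longrightarrow> \<beta> \<prec> \<alpha> \<and> A \<inter> seg \<gamma> = a \<beta>"
      using A(4) A_below by (metis seg_iff)
    then obtain idx where idx: "\<And>\<gamma>. \<gamma> \<in> A \<Longrightarrow> idx \<gamma> \<prec> \<alpha> \<and> A \<inter> seg \<gamma> = a (idx \<gamma>)"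
      by metis
    \<comment> \<open>\<open>A\<close> and \<open>B\<close> are interleaved, \<gamma> <
      \<open>bf \<gamma>\<close> < \<open>d \<gamma>\<close>, so that \<open>d \<gamma>\<close> lies
      in the listed set \<open>a (idx \<gamma>')\<close> whenever \<open>d \<gamma>\<close> <
      \<gamma>'.\<close>
    have "\<forall>\<gamma>. \<exists>b. \<gamma> \<in> A \<longrightarrow> b \<in> B \<and> idx \<gamma> \<prec> b \<and> \<gamma> \<prec> b"
      using above[OF B] idx A_below by blast
    then obtain bf where bf: "\<And>\<gamma>. \<gamma> \<in> A \<Longrightarrow> bf \<gamma> \<in> B \<and> idx \<gamma> \<prec> bf \<gamma> \<and> \<gamma> \<prec> bf \<gamma>"
      by metis
    have "\<forall>\<gamma>. \<exists>d. \<gamma> \<in> A \<longrightarrow> d \<in> A \<and> bf \<gamma> \<prec> d"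
      using above[OF A(1)] bf B_below by blast
    then obtain d where d: "\<And>\<gamma>. \<gamma> \<in> A \<Longrightarrow> d \<gamma> \<in> A \<and> bf \<gamma> \<prec> d \<gamma>"
      by metis
    \<comment> \<open>The maximum of the two codes needed below i: that of
      \<open>bf \<gamma>\<close> in \<open>d \<gamma>\<close>, and that of the index
      \<open>idx \<gamma>\<close> in \<open>bf \<gamma>\<close>.\<close>
    define r where "r \<gamma> = (let x = e (d \<gamma>) (bf \<gamma>); y = e (bf \<gamma>) (idx \<gamma>) in if x \<prec> y then y else x)" for \<gamma>
    have r: "e (d \<gamma>) (bf \<gamma>) \<preceq> r \<gamma>" "e (bf \<gamma>) (idx \<gamma>) \<preceq> r \<gamma>" for \<gamma>
      unfolding r_def Let_def by (auto simp: ord.less_imp_le ord.not_less)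
    have "r \<gamma> \<prec> l" if "\<gamma> \<in> A" for \<gamma>
      unfolding r_def Let_def using e(2) bf[OF that] d[OF that] by simp
    then obtain i where i: "i \<prec> l" "cle (seg t) {\<gamma>\<in>A. r \<gamma> \<prec> i}"
      using small_target[OF t_reg l_card l_inf t_ne_cf ceqA] by blast
    define Y where "Y = {\<gamma>\<in>A. r \<gamma> \<prec> i}"
    have Y: "cle (seg t) Y" "Y \<subseteq> A"
      using i unfolding Y_def by auto
    define p where "p \<gamma> = rk i (bf \<gamma>)" for \<gamma>
    \<comment> \<open>The ranks are compared through \<open>d \<gamma>\<close>:
      \<open>bf \<gamma>\<close> precedes it by the first disjunct of \<open>G\<close>, and it
      precedes \<open>bf \<gamma>'\<close> by the second.\<close>
    have p_less: "p \<gamma> \<prec> p \<gamma>'" if "\<gamma> \<in> Y" "\<gamma>' \<in> Y" "d \<gamma> \<prec> \<gamma>'" for \<gamma> \<gamma>'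
    proof -
      have \<gamma>: "\<gamma> \<in> A" "\<gamma>' \<in> A" "r \<gamma> \<prec> i" "r \<gamma>' \<prec> i"
        using that unfolding Y_def by auto
      have "bf \<gamma> \<in> G i (d \<gamma>)"
        unfolding G_def using d[OF \<gamma>(1)] ord.le_less_trans[OF r(1) \<gamma>(3)] by blast
      then have 1: "p \<gamma> \<prec> rk i (d \<gamma>)"
        unfolding p_def by (rule rk(1))
      have eq: "a (idx \<gamma>') = A \<inter> seg \<gamma>'"
        using idx[OF \<gamma>(2)] by simp
      have "cle (a (idx \<gamma>')) (seg t)"
        unfolding eq by (rule cle_trans[OF cle_subset]) (use ceqA in \<open>auto simp: ceq_iff\<close>)
      moreover have "d \<gamma> \<in> a (idx \<gamma>')"
        unfolding eq using d[OF \<gamma>(1)] that(3) by simp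
      moreover have "d \<gamma> \<prec> bf \<gamma>'"
        using that(3) bf[OF \<gamma>(2)] ord.less_trans by blast
      ultimately have "d \<gamma> \<in> G i (bf \<gamma>')"
        unfolding G_def using bf[OF \<gamma>(2)] ord.le_less_trans[OF r(2) \<gamma>(4)] by blast
      then have "rk i (d \<gamma>) \<prec> p \<gamma>'"
        unfolding p_def by (rule rk(1))
      with 1 show ?thesis
        by (rule ord.less_trans)
    qed
    have big: "cle (seg t) (p ` Y)"
    proof (rule ccontr)
      assume "\<not> ?thesis"
      then obtain z where z: "cle (seg t) {\<gamma>\<in>Y. p \<gamma> = z}"
        using pigeonhole[OF t_reg Y(1)] by blast
      have cof: "\<exists>\<gamma>\<in>{\<gamma>\<in>Y. p \<gamma> = z}. \<beta> \<preceq> \<gamma>" if "\<beta> \<prec> \<alpha>" for \<beta>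
        by (rule thin_cofinal[OF thin _ z that]) (use Y(2) in blast)
      obtain \<gamma> where \<gamma>: "\<gamma> \<in> Y" "p \<gamma> = z"
        using cof limit_nonempty[OF lim] by blast
      then have "d \<gamma> \<prec> \<alpha>"
        using d A_below Y(2) by blast
      then obtain \<beta> where "d \<gamma> \<prec> \<beta>" "\<beta> \<prec> \<alpha>"
        using limitD[OF lim] by blast
      then obtain \<gamma>' where "\<gamma>' \<in> Y" "p \<gamma>' = z" "d \<gamma> \<prec> \<gamma>'"
        using cof ord.less_le_trans by blast
      then show False
        using p_less[OF \<gamma>(1)] \<gamma>(2) by fastforce
    qed
    obtain Z where Z: "Z \<subseteq> Y" "inj_on p Z" "p ` Z = p ` Y"
      using exists_section[of Y p] by blast
    define q where "q = the_inv_into Z p"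
    have q: "q (p x) = x" if "x \<in> Z" for x
      unfolding q_def using the_inv_into_f_f[OF Z(2) that] .
    have "\<exists>h\<in>H. cle (seg t) {x\<in>p ` Z. e (bf (q x)) (f (bf (q x))) \<in> h x}"
    proof (rule hit)
      show "p ` Z \<subseteq> seg l"
        unfolding p_def using rk_l[OF i(1)] by auto
      show "cle (seg t) (p ` Z)"
        using big Z(3) by simp
      fix x assume "x \<in> p ` Z"
      then have "q x \<in> A"
        using q Z(1) Y(2) by auto
      then have "bf (q x) \<prec> \<alpha>" "q x \<prec> bf (q x)"
        using bf B_below by blast+
      then have "f (bf (q x)) \<prec> bf (q x)"
        using f unfolding regressive_on_def by (metis empty_iff seg_iff)
      then show "e (bf (q x)) (f (bf (q x))) \<prec> l"
        by (rule e(2))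
    qed
    then obtain h where h: "h \<in> H" "cle (seg t) {x\<in>p ` Z. e (bf (q x)) (f (bf (q x))) \<in> h x}"
      by blast
    define W where "W = {\<gamma>\<in>Z. e (bf \<gamma>) (f (bf \<gamma>)) \<in> h (p \<gamma>)}"
    have "{x\<in>p ` Z. e (bf (q x)) (f (bf (q x))) \<in> h x} \<subseteq> p ` W"
      unfolding W_def using q by auto
    then have W: "cle (seg t) W"
      by (rule cle_trans[OF h(2) cle_surj])
    have WA: "W \<subseteq> A"
      unfolding W_def using Z(1) Y(2) by blast
    have j: "enc (i, h) \<prec> l"
      using enc(2) i(1) h(1) by (metis SigmaI image_subset_iff seg_iff)
    have hit_F: "f (bf \<gamma>) \<in> F (enc (i, h)) (bf \<gamma>)" if "\<gamma> \<in> W" for \<gamma>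
    proof -
      have "\<gamma> \<in> A"
        using that WA by blast
      then have "bf \<gamma> \<prec> \<alpha>" "\<gamma> \<prec> bf \<gamma>"
        using bf B_below by blast+
      then have "f (bf \<gamma>) \<prec> bf \<gamma>"
        using f unfolding regressive_on_def by (metis empty_iff seg_iff)
      then show ?thesis
        using that i(1) h(1) unfolding W_def F_def p_def by blast
    qed
    have "sup_is R {\<beta>\<in>B. f \<beta> \<in> F (enc (i, h)) \<beta>} \<alpha>"
      unfolding sup_is_def
    proof (intro conjI ballI)
      show "{\<beta>\<in>B. f \<beta> \<in> F (enc (i, h)) \<beta>} \<subseteq> seg \<alpha>"
        using B_below by auto
      fix y assume "y \<in> seg \<alpha>"
      then obtain \<gamma> where \<gamma>: "\<gamma> \<in> W" "y \<preceq> \<gamma>"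
        using thin_cofinal[OF thin WA W] by auto
      then have "bf \<gamma> \<in> B" "\<gamma> \<prec> bf \<gamma>"
        using bf WA by blast+
      then show "\<exists>x\<in>{\<beta>\<in>B. f \<beta> \<in> F (enc (i, h)) \<beta>}. y \<prec> x"
        using hit_F[OF \<gamma>(1)] ord.le_less_trans[OF \<gamma>(2)] by blast
    qed
    moreover have "enc (i, h) \<in> seg \<alpha>"
      using ord.less_trans[OF j \<alpha>(3)] by simp
    ultimately show ?thesis
      by blast
  qed
  show ?thesis
    unfolding J_ideal_def using club_tail[OF C] F_small main by blast
qed

section \<open>Stationarily many approachable points\<close>

text \<open>Defined without a club, so that membership in the ideal can be shown with the club of
  all ordinals.\<close>

definition approachable :: "('a \<Rightarrow> 'a set) \<Rightarrow> 'a set" where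
  "approachable a = {\<alpha>. \<exists>A. thin t \<alpha> A \<and> (\<forall>\<gamma>. \<gamma> \<prec> \<alpha> \<longrightarrow> (\<exists>\<beta>. \<beta> \<prec> \<alpha> \<and> A \<inter> seg \<gamma> = a \<beta>))}"

lemma approachable_sub: "approachable a \<subseteq> E_cof R t"
  unfolding approachable_def E_cof_def using thin_cf[OF _ t_reg] by blast

lemma approachable_in_I:
  assumes "\<And>\<beta>. \<exists>\<gamma>. a \<beta> \<subseteq> seg \<gamma>"
  shows "approachable a \<in> I_ideal R"
proof -
  have "\<exists>y. x \<prec> y" for x
    using succ_seg_bounded[OF U0, of "{x}"] cle_finite[of "{x}" "seg l"] l_inf by auto
  then have C: "club R UNIV"
    unfolding club_UNIV club_in_def by blast
  have "\<exists>A. cofinal_in R A \<alpha> \<and> (\<exists>t. cf_is R \<alpha> t \<and> (Restr R A, Restr R (seg t)) \<in> ordIso) \<and>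
      (\<forall>\<gamma>\<in>seg \<alpha>. \<exists>\<beta>\<in>seg \<alpha>. A \<inter> seg \<gamma> = a \<beta>)" if "\<alpha> \<in> approachable a" for \<alpha>
  proof -
    obtain A where A: "thin t \<alpha> A" "\<And>\<gamma>. \<gamma> \<prec> \<alpha> \<Longrightarrow> \<exists>\<beta>. \<beta> \<prec> \<alpha> \<and> A \<inter> seg \<gamma> = a \<beta>"
      using \<open>\<alpha> \<in> approachable a\<close> unfolding approachable_def by blast
    have A': "A \<subseteq> seg \<alpha>" "cle (seg t) A"
      using A(1) unfolding thin_def ceq_iff by blast+
    have "cofinal_in R A \<alpha>"
      by (rule cofinalI) (use A'(1) thin_cofinal[OF A(1) order_refl A'(2)] in auto)
    moreover have "cf_is R \<alpha> t" "(Restr R A, Restr R (seg t)) \<in> ordIso"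
      by (rule thin_cf[OF A(1) t_reg], rule thin_ordIso[OF A(1) t_card])
    moreover have "\<forall>\<gamma>\<in>seg \<alpha>. \<exists>\<beta>\<in>seg \<alpha>. A \<inter> seg \<gamma> = a \<beta>"
      using A(2) by (metis seg_iff)
    ultimately show ?thesis
      by blast
  qed
  then show ?thesis
    unfolding I_ideal_def using C assms by blast
qed

lemma triple_surj: "\<exists>\<pi> :: 'a \<Rightarrow> 'a \<times> 'a \<times> 'a. surj \<pi>"
proof -
  have inf: "infinite (UNIV :: 'a set)"
    using infinite_super[OF subset_UNIV l_inf] .
  have "cle ((UNIV :: 'a set) \<times> (UNIV :: 'a set) \<times> (UNIV :: 'a set)) (UNIV :: 'a set)"
    by (intro cle_Times inf cle_refl)
  then show ?thesis
    using cle_inv[of "(UNIV :: 'a set) \<times> (UNIV :: 'a set) \<times> (UNIV :: 'a set)" "UNIV :: 'a set"] by simp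
qed

text \<open>While \<open>\<xi>\<close> is built, its values are kept above the index of each \<open>\<xi> ` (K \<epsilon> \<inter> seg k)\<close> that is listed
  at all by \<open>a\<close>.  Only the limit \<open>\<delta> = \<xi> \<sigma>\<close> reveals that the sets that matter are listed: on a club of \<open>\<sigma>\<close>, \<open>\<xi>\<close>
  agrees with the normal function \<open>e \<delta>\<close>, which was fixed in advance.\<close>

lemma stationary_approachable_guess:
  assumes s: "succ_seg (seg s) t" and \<sigma>: "succ_seg (seg \<sigma>) s" and t\<sigma>: "t \<prec> \<sigma>"
  shows "\<exists>a. (\<forall>\<beta>. \<exists>\<gamma>. a \<beta> \<subseteq> seg \<gamma>) \<and> stationary R (approachable a)"
proof -
  obtain K where K: "\<And>E. club_in (seg \<sigma>) E \<Longrightarrow> \<exists>\<epsilon>. \<epsilon> \<prec> \<sigma> \<and> thin t \<epsilon> (K \<epsilon>) \<and> K \<epsilon> \<subseteq> E"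
    using club_guessing[OF s \<sigma> t_reg t\<sigma>] by blast
  obtain \<pi> :: "'a \<Rightarrow> 'a \<times> 'a \<times> 'a" where \<pi>: "surj \<pi>"
    using triple_surj by blast
  define e where "e \<delta> = (SOME f. normal_to \<sigma> f \<delta>)" for \<delta>
  \<comment> \<open>Intersecting with \<open>seg \<delta>\<close> keeps the set bounded also where
    no normal function from \<sigma> to \<delta> exists and \<open>e \<delta>\<close> is
    arbitrary.\<close>
  define a where "a b = (case \<pi> b of (\<delta>, \<epsilon>, j) \<Rightarrow> e \<delta> ` (K \<epsilon> \<inter> seg j) \<inter> seg \<delta>)" for b
  have a_bd: "\<exists>\<gamma>. a \<beta> \<subseteq> seg \<gamma>" for \<beta>
    unfolding a_def by (cases "\<pi> \<beta>") auto
  have s_inf: "infinite (seg s)"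
    using \<sigma> unfolding succ_seg_def by blast
  have lim_\<sigma>: "is_limit R \<sigma>"
    unfolding is_limit_def
  proof (intro conjI ballI)
    show "seg \<sigma> \<noteq> {}" using t\<sigma> by auto
    fix \<beta> assume "\<beta> \<in> seg \<sigma>"
    then show "\<exists>\<gamma>\<in>seg \<sigma>. \<beta> \<prec> \<gamma>"
      using succ_seg_bounded[OF \<sigma>, of "{\<beta>}"] cle_finite[of "{\<beta>}" "seg s"] s_inf by simp
  qed
  have "approachable a \<inter> D \<noteq> {}" if D: "club R D" for D
  proof -
    \<comment> \<open>For a set that is not listed this is an arbitrary ordinal, which merely adds a
      lower bound for later values of \<xi>.\<close>
    define idx where "idx Z = least (\<lambda>b. a b = Z)" for Z
    define \<Psi> where "\<Psi> \<xi> k = (\<lambda>\<epsilon>. idx (\<xi> ` (K \<epsilon> \<inter> seg k))) ` seg \<sigma>" for \<xi> k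
    obtain \<xi> where \<xi>: "\<And>i. \<xi> i \<in> D" "\<And>i k. k \<prec> i \<Longrightarrow> \<xi> k \<prec> \<xi> i"
      "\<And>i k x. k \<prec> i \<Longrightarrow> x \<in> \<Psi> \<xi> k \<Longrightarrow> x \<prec> \<xi> i"
      "\<And>i y. is_limit R i \<Longrightarrow> y \<prec> \<xi> i \<Longrightarrow> \<exists>k. k \<prec> i \<and> y \<prec> \<xi> k"
    proof (rule normal_function[OF U0 D[unfolded club_UNIV], of \<Psi>])
      show "\<Psi> f k = \<Psi> g k" if "\<And>j. j \<preceq> k \<Longrightarrow> f j = g j" for f g k
      proof -
        have "f ` (K \<epsilon> \<inter> seg k) = g ` (K \<epsilon> \<inter> seg k)" for \<epsilon>
          using that ord.less_imp_le by (intro image_cong) auto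
        then show ?thesis
          unfolding \<Psi>_def by simp
      qed
      show "\<Psi> f k \<subseteq> UNIV \<and> cle (\<Psi> f k) (seg l)" for f k
        unfolding \<Psi>_def using cle_image_le[OF succ_bound] by simp
    qed (use that in auto)
    define \<delta> where "\<delta> = \<xi> \<sigma>"
    have \<xi>_le: "\<xi> k \<preceq> \<xi> i" if "k \<preceq> i" for i k
      using that \<xi>(2)[of k i] by (auto simp: ord.le_less)
    have \<xi>_refl: "k \<prec> i" if "\<xi> k \<prec> \<xi> i" for i k
      using that \<xi>_le ord.leD ord.not_le by blast
    have nf: "normal_to \<sigma> \<xi> \<delta>"
      unfolding normal_to_def \<delta>_def using \<xi>(2,4) lim_\<sigma> by blast
    then have ne: "normal_to \<sigma> (e \<delta>) \<delta>"
      unfolding e_def by (rule someI[of "\<lambda>f. normal_to \<sigma> f \<delta>"])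
    obtain \<epsilon> where \<epsilon>: "\<epsilon> \<prec> \<sigma>" "thin t \<epsilon> (K \<epsilon>)" "K \<epsilon> \<subseteq> {i. i \<prec> \<sigma> \<and> \<xi> i = e \<delta> i}"
      using K[OF normal_to_agree[OF \<sigma> nf ne]] by blast
    have K': "K \<epsilon> \<subseteq> seg \<epsilon>" "cle (seg t) (K \<epsilon>)" "cle (K \<epsilon>) (seg t)"
        "\<And>y. y \<prec> \<epsilon> \<Longrightarrow> \<not> cle (seg t) (K \<epsilon> \<inter> seg y)"
      using \<epsilon>(2) unfolding thin_def ceq_iff by blast+
    have lim_\<epsilon>: "is_limit R \<epsilon>"
      by (rule cf_limit[OF thin_cf[OF \<epsilon>(2) t_reg] t_inf])
    define A where "A = \<xi> ` K \<epsilon>"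
    have inj: "inj_on \<xi> (K \<epsilon>)"
      by (rule inj_onI) (metis \<xi>(2) ord.less_irrefl ord.linorder_cases)
    have hit: "\<exists>j\<in>K \<epsilon>. y \<preceq> \<xi> j" if "y \<prec> \<xi> \<epsilon>" for y
    proof -
      obtain k where k: "k \<prec> \<epsilon>" "y \<prec> \<xi> k"
        using \<xi>(4)[OF lim_\<epsilon> \<open>y \<prec> \<xi> \<epsilon>\<close>] by blast
      obtain j where j: "j \<in> K \<epsilon>" "k \<preceq> j"
        using thin_cofinal[OF \<epsilon>(2) order_refl K'(2) k(1)] by blast
      have "y \<preceq> \<xi> j"
        using ord.less_le_trans[OF k(2) \<xi>_le[OF j(2)]] ord.less_imp_le by blast
      then show ?thesis
        using j(1) by blast
    qed
    have thin: "thin t (\<xi> \<epsilon>) A"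
      unfolding thin_def ceq_iff
    proof (intro conjI allI impI)
      show "A \<subseteq> seg (\<xi> \<epsilon>)"
        unfolding A_def using K'(1) \<xi>(2) by auto
      show "cle A (seg t)"
        unfolding A_def by (rule cle_image_le[OF K'(3)])
      show "cle (seg t) A"
        unfolding A_def by (rule cle_trans[OF K'(2) cle_inj_image[OF inj]])
      fix y assume "y \<prec> \<xi> \<epsilon>"
      then obtain k where k: "k \<prec> \<epsilon>" "y \<prec> \<xi> k"
        using \<xi>(4)[OF lim_\<epsilon>] by blast
      have "A \<inter> seg y \<subseteq> \<xi> ` (K \<epsilon> \<inter> seg k)"
        unfolding A_def using \<xi>_refl ord.less_trans[OF _ k(2)] by auto
      then have "cle (A \<inter> seg y) (K \<epsilon> \<inter> seg k)"
        by (rule cle_surj)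
      then show "\<not> cle (seg t) (A \<inter> seg y)"
        using K'(4)[OF k(1)] cle_trans by blast
    qed
    have "\<exists>\<beta>. \<beta> \<prec> \<xi> \<epsilon> \<and> A \<inter> seg \<gamma> = a \<beta>" if \<gamma>: "\<gamma> \<prec> \<xi> \<epsilon>" for \<gamma>
    proof -
      \<comment> \<open>The first element of \<open>K \<epsilon>\<close> whose value reaches
        \<gamma>, so that cutting \<open>A\<close> at \<gamma> amounts to cutting
        \<open>K \<epsilon>\<close> at j.\<close>
      define j where "j = least (\<lambda>j. j \<in> K \<epsilon> \<and> \<gamma> \<preceq> \<xi> j)"
      obtain j' where "j' \<in> K \<epsilon> \<and> \<gamma> \<preceq> \<xi> j'"
        using hit[OF \<gamma>] by blast
      then have j: "j \<in> K \<epsilon>" "\<gamma> \<preceq> \<xi> j"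
        unfolding j_def using leastI[of "\<lambda>j. j \<in> K \<epsilon> \<and> \<gamma> \<preceq> \<xi> j" j'] by blast+
      have jmin: "\<xi> x \<prec> \<gamma>" if "x \<in> K \<epsilon>" "x \<prec> j" for x
        using not_less_least[of x "\<lambda>j. j \<in> K \<epsilon> \<and> \<gamma> \<preceq> \<xi> j"] that unfolding j_def
        by (auto simp: ord.not_le)
      have eq: "A \<inter> seg \<gamma> = \<xi> ` (K \<epsilon> \<inter> seg j)"
        unfolding A_def using jmin \<xi>_refl ord.less_le_trans[OF _ j(2)] by auto
      \<comment> \<open>This only shows that the set is listed: b depends on \<delta>, which lies
        above \<open>\<xi> \<epsilon>\<close>. The least index is the one that
        \<open>\<Psi>\<close>, at stage j, has kept below \<open>\<xi> \<epsilon>\<close>.\<close>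
      obtain b where b: "\<pi> b = (\<delta>, \<epsilon>, j)"
        using \<pi> by (metis surjD)
      have "\<xi> x = e \<delta> x \<and> \<xi> x \<prec> \<delta>" if "x \<in> K \<epsilon>" for x
        unfolding \<delta>_def[symmetric] using \<epsilon>(3) that \<xi>(2)[of x \<sigma>] unfolding \<delta>_def by blast
      then have "\<xi> ` (K \<epsilon> \<inter> seg j) = e \<delta> ` (K \<epsilon> \<inter> seg j) \<inter> seg \<delta>"
        by (force simp: image_iff)
      then have "a b = \<xi> ` (K \<epsilon> \<inter> seg j)"
        unfolding a_def b by simp
      then have "a (idx (\<xi> ` (K \<epsilon> \<inter> seg j))) = \<xi> ` (K \<epsilon> \<inter> seg j)"
        unfolding idx_def by (rule leastI)
      moreover have "idx (\<xi> ` (K \<epsilon> \<inter> seg j)) \<prec> \<xi> \<epsilon>"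
      proof (rule \<xi>(3))
        show "j \<prec> \<epsilon>"
          using subsetD[OF K'(1) j(1)] by simp
        show "idx (\<xi> ` (K \<epsilon> \<inter> seg j)) \<in> \<Psi> \<xi> j"
          unfolding \<Psi>_def using \<epsilon>(1) by auto
      qed
      ultimately show ?thesis
        using eq by metis
    qed
    then have "\<xi> \<epsilon> \<in> approachable a"
      unfolding approachable_def using thin by blast
    then show ?thesis
      using \<xi>(1) by blast
  qed
  then show ?thesis
    unfolding stationary_def using a_bd by blast
qed

text \<open>The set \<open>N\<close> in the proof satisfies \<open>N \<inter> seg y = G i y\<close> for \<open>y \<in> N\<close>, so that its initial segments, and
  those of subsets defined from the rank, depend only on \<open>y\<close> and on parameters below \<open>l\<close>.\<close>

lemma stationary_approachable_successor:
  assumes lt: "succ_seg (seg l) t"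
  shows "\<exists>a. (\<forall>\<beta>. \<exists>\<gamma>. a \<beta> \<subseteq> seg \<gamma>) \<and> stationary R (approachable a)"
proof -
  have "\<forall>b. \<exists>e. inj_on e (seg b) \<and> e ` seg b \<subseteq> seg l"
    using succ_bound unfolding cle_iff by blast
  then obtain e where e: "\<And>b. inj_on (e b) (seg b)" "\<And>b x. x \<prec> b \<Longrightarrow> e b x \<prec> l"
    by (metis image_subset_iff seg_iff)
  define G where "G i b = {x. x \<prec> b \<and> e b x \<prec> i}" for i b
  have G_sub: "G i b \<subseteq> seg b" for i b
    unfolding G_def by auto
  have G_small: "cle (G i b) (seg t)" if "i \<prec> l" for i b
  proof -
    have "cle (G i b) (seg i)"
      by (rule cleI[of "e b"]) (use e(1) in \<open>auto simp: inj_on_def G_def\<close>)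
    then show ?thesis
      using lt that cle_trans unfolding succ_seg_def by (metis seg_iff)
  qed
  have "\<forall>i. \<exists>rk. \<forall>x. (\<forall>z\<in>G i x. rk z \<prec> rk x) \<and> (\<forall>y. y \<prec> rk x \<longrightarrow> (\<exists>z\<in>G i x. y \<preceq> rk z))"
    by (intro allI rank_exists G_sub)
  from choice[OF this] obtain rk where "\<forall>i x. (\<forall>z\<in>G i x. rk i z \<prec> rk i x) \<and>
      (\<forall>y. y \<prec> rk i x \<longrightarrow> (\<exists>z\<in>G i x. y \<preceq> rk i z))"
    by (elim exE)
  then have rk: "\<And>i x z. z \<in> G i x \<Longrightarrow> rk i z \<prec> rk i x"
      "\<And>i x y. y \<prec> rk i x \<Longrightarrow> \<exists>z\<in>G i x. y \<preceq> rk i z"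
    by blast+
  have rk_l: "rk i x \<prec> l" if "i \<prec> l" for i x
    by (rule rank_below[OF G_small[OF that] t_inf t_lt_l rk(2) G_sub])
  define cofmap where "cofmap \<zeta> v \<longleftrightarrow> (\<forall>i j. i \<prec> j \<and> j \<prec> t \<longrightarrow> v i \<prec> v j) \<and>
      (\<forall>i. i \<prec> t \<longrightarrow> v i \<prec> \<zeta>) \<and> (\<forall>y. y \<prec> \<zeta> \<longrightarrow> (\<exists>i. i \<prec> t \<and> y \<prec> v i))" for \<zeta> v
  define v where "v \<zeta> = (SOME v. cofmap \<zeta> v)" for \<zeta>
  \<comment> \<open>The x at which the rank first reaches some term of \<open>v \<zeta>\<close>: all
    predecessors have rank below that term, and x does not.\<close>
  define Q where "Q \<beta> i \<zeta> = {x\<in>G i \<beta>. \<exists>k. k \<prec> t \<and> v \<zeta> k \<preceq> rk i x \<and> (\<forall>z\<in>G i x. rk i z \<prec> v \<zeta> k)}"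
    for \<beta> i \<zeta>
  obtain \<pi> :: "'a \<Rightarrow> 'a \<times> 'a \<times> 'a" where \<pi>: "surj \<pi>"
    using triple_surj by blast
  define a where "a b = (case \<pi> b of (\<beta>, i, \<zeta>) \<Rightarrow> Q \<beta> i \<zeta>)" for b
  have "Q \<beta> i \<zeta> \<subseteq> seg \<beta>" for \<beta> i \<zeta>
    unfolding Q_def using G_sub by blast
  then have a_bd: "\<exists>\<gamma>. a \<beta> \<subseteq> seg \<gamma>" for \<beta>
    unfolding a_def by (cases "\<pi> \<beta>") (simp, blast)
  have lim_t: "is_limit R t"
    by (rule cardinal_limit[OF t_card t_inf])
  have "approachable a \<inter> D \<noteq> {}" if D: "club R D" for D
  proof -
    define idx where "idx Z = least (\<lambda>b. a b = Z)" for Z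
    define \<Psi> where "\<Psi> \<xi> k = (\<lambda>(\<beta>, i, \<zeta>). idx (Q \<beta> i \<zeta>)) ` (insert (\<xi> k) (seg (\<xi> k)) \<times> seg l \<times> seg l)"
      for \<xi> :: "'a \<Rightarrow> 'a" and k
    obtain \<xi> where \<xi>: "\<And>i. \<xi> i \<in> D" "\<And>i k. k \<prec> i \<Longrightarrow> \<xi> k \<prec> \<xi> i"
      "\<And>i k x. k \<prec> i \<Longrightarrow> x \<in> \<Psi> \<xi> k \<Longrightarrow> x \<prec> \<xi> i"
      "\<And>i y. is_limit R i \<Longrightarrow> y \<prec> \<xi> i \<Longrightarrow> \<exists>k. k \<prec> i \<and> y \<prec> \<xi> k"
    proof (rule normal_function[OF U0 D[unfolded club_UNIV], of \<Psi>])
      show "\<Psi> f k = \<Psi> g k" if "\<And>j. j \<preceq> k \<Longrightarrow> f j = g j" for f g k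
        unfolding \<Psi>_def using that[of k] by simp
      show "\<Psi> f k \<subseteq> UNIV \<and> cle (\<Psi> f k) (seg l)" for f k
        unfolding \<Psi>_def
        by (intro conjI cle_image_le cle_Times l_inf cle_insert succ_bound cle_refl) simp
    qed (use that in auto)
    define \<alpha> where "\<alpha> = \<xi> t"
    have cof: "\<exists>k. k \<prec> t \<and> y \<prec> \<xi> k" if "y \<prec> \<alpha>" for y
      using \<xi>(4)[OF lim_t] that unfolding \<alpha>_def by blast
    have \<xi>\<alpha>: "\<xi> k \<prec> \<alpha>" if "k \<prec> t" for k
      unfolding \<alpha>_def by (rule \<xi>(2)[OF that])
    have cf: "cf_is R \<alpha> t"
      by (rule cf_from_map[OF t_reg, of \<xi>]) (use \<xi>(2) \<xi>\<alpha> cof ord.less_imp_le in blast)+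
    \<comment> \<open>Only \<theta> many codes have to be exceeded, and \<lambda> is regular. After
      \<omega> steps the two requirements become the two inclusions of
      \<open>G i y = N \<inter> seg y\<close>.\<close>
    have step: "\<exists>j\<in>seg l. i \<prec> j \<and> (\<forall>x\<in>G i \<alpha>. \<forall>y\<in>G i \<alpha>. x \<prec> y \<longrightarrow> e y x \<prec> j) \<and>
        (\<forall>y\<in>G i \<alpha>. \<forall>x\<in>G i y. e \<alpha> x \<prec> j)" if i: "i \<in> seg l" for i
    proof -
      have il: "i \<prec> l" using i by simp
      define X where "X = insert i ((\<Union>y\<in>G i \<alpha>. e y ` (G i \<alpha> \<inter> seg y)) \<union> e \<alpha> ` (\<Union>y\<in>G i \<alpha>. G i y))"
      have "cle (\<Union>y\<in>G i \<alpha>. e y ` (G i \<alpha> \<inter> seg y)) (seg t)"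
        by (intro cle_UN t_inf G_small[OF il] cle_image_le cle_trans[OF cle_subset G_small[OF il, of \<alpha>]]) blast
      moreover have "cle (e \<alpha> ` (\<Union>y\<in>G i \<alpha>. G i y)) (seg t)"
        by (intro cle_image_le cle_UN t_inf G_small[OF il])
      ultimately have "cle X (seg t)"
        unfolding X_def by (intro cle_insert cle_Un t_inf)
      moreover have "X \<subseteq> seg l"
      proof -
        have "e y x \<prec> l" if "x \<in> G i \<alpha> \<inter> seg y" for x y
          using e(2) that by simp
        moreover have "e \<alpha> x \<prec> l" if "y \<in> G i \<alpha>" "x \<in> G i y" for x y
          using e(2) that ord.less_trans unfolding G_def by blast
        ultimately show ?thesis
          unfolding X_def using il by auto
      qed
      ultimately obtain j where j: "j \<in> seg l" "\<forall>x\<in>X. x \<prec> j"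
        using succ_seg_bounded[OF lt] by blast
      have "e y x \<prec> j" if "x \<in> G i \<alpha>" "y \<in> G i \<alpha>" "x \<prec> y" for x y
        by (rule bspec[OF j(2)], unfold X_def, rule insertI2, rule UnI1, rule UN_I[of y])
          (use that in auto)
      moreover have "e \<alpha> x \<prec> j" if "y \<in> G i \<alpha>" "x \<in> G i y" for x y
        by (rule bspec[OF j(2)], unfold X_def, rule insertI2, rule UnI2, rule imageI, rule UN_I[of y])
          (use that in auto)
      moreover have "i \<prec> j"
        by (rule bspec[OF j(2)]) (simp add: X_def)
      ultimately show ?thesis
        using j(1) by blast
    qed
    \<comment> \<open>Starting above the codes of all \<open>\<xi> k\<close> puts the whole cofinal
      sequence into \<open>N\<close>.\<close>
    obtain i0 where i0: "i0 \<in> seg l" "\<And>k. k \<prec> t \<Longrightarrow> e \<alpha> (\<xi> k) \<prec> i0"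
    proof -
      have "cle ((\<lambda>k. e \<alpha> (\<xi> k)) ` seg t) (seg t)"
        by (rule cle_image)
      moreover have "(\<lambda>k. e \<alpha> (\<xi> k)) ` seg t \<subseteq> seg l"
        using e(2) \<xi>\<alpha> by auto
      ultimately show thesis
        using succ_seg_bounded[OF lt, of "(\<lambda>k. e \<alpha> (\<xi> k)) ` seg t"] that by auto
    qed
    have "\<exists>u. \<forall>n. (u n \<in> seg l \<and> (n = 0 \<longrightarrow> u n = i0)) \<and>
      (u n \<prec> u (Suc n) \<and> (\<forall>x\<in>G (u n) \<alpha>. \<forall>y\<in>G (u n) \<alpha>. x \<prec> y \<longrightarrow> e y x \<prec> u (Suc n)) \<and>
        (\<forall>y\<in>G (u n) \<alpha>. \<forall>x\<in>G (u n) y. e \<alpha> x \<prec> u (Suc n)))"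
      by (rule dependent_nat_choice) (use i0(1) step in \<open>simp_all add: Bex_def\<close>)
    then obtain u :: "nat \<Rightarrow> 'a" where "\<forall>n. (u n \<in> seg l \<and> (n = 0 \<longrightarrow> u n = i0)) \<and>
      (u n \<prec> u (Suc n) \<and> (\<forall>x\<in>G (u n) \<alpha>. \<forall>y\<in>G (u n) \<alpha>. x \<prec> y \<longrightarrow> e y x \<prec> u (Suc n)) \<and>
        (\<forall>y\<in>G (u n) \<alpha>. \<forall>x\<in>G (u n) y. e \<alpha> x \<prec> u (Suc n)))"
      by (elim exE)
    then have u: "u 0 = i0" "\<And>n. u n \<in> seg l" "\<And>n. u n \<prec> u (Suc n)"
        "\<And>n x y. x \<in> G (u n) \<alpha> \<Longrightarrow> y \<in> G (u n) \<alpha> \<Longrightarrow> x \<prec> y \<Longrightarrow> e y x \<prec> u (Suc n)"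
        "\<And>n x y. y \<in> G (u n) \<alpha> \<Longrightarrow> x \<in> G (u n) y \<Longrightarrow> e \<alpha> x \<prec> u (Suc n)"
      by blast+
    obtain i where i': "i \<in> seg l" and i: "\<And>n. u n \<prec> i" "\<And>y. y \<prec> i \<Longrightarrow> \<exists>n. y \<prec> u n"
      using omega_sup[OF lt, of u] u(2,3) by blast
    have il: "i \<prec> l" using i' by simp
    have u_mono: "x \<prec> u n" if "x \<prec> u m" "m \<le> n" for x m n
      using ord.lift_Suc_mono_le[of u m n] u(3) that ord.less_imp_le ord.less_le_trans by blast
    define N where "N = G i \<alpha>"
    have N_small: "cle N (seg t)"
      unfolding N_def by (rule G_small[OF il])
    have N_level: "\<exists>n. x \<in> G (u n) \<alpha>" if "x \<in> N" for x
      using that i(2) unfolding N_def G_def by blast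
    have G_mono: "x \<in> G (u n) y" if "x \<in> G (u m) y" "m \<le> n" for x y m n
      using that u_mono unfolding G_def by blast
    have \<xi>N: "\<xi> k \<in> N" if "k \<prec> t" for k
      unfolding N_def G_def using \<xi>\<alpha>[OF that] i0(2)[OF that] i(1)[of 0] u(1) ord.less_trans by auto
    have GN: "G i y = N \<inter> seg y" if y: "y \<in> N" for y
    proof (intro equalityI subsetI)
      fix x assume x: "x \<in> G i y"
      then have "x \<prec> y" "e y x \<prec> i"
        unfolding G_def by auto
      then obtain n where n: "x \<in> G (u n) y"
        using i(2) unfolding G_def by blast
      obtain m where m: "y \<in> G (u m) \<alpha>"
        using N_level[OF y] by blast
      have "e \<alpha> x \<prec> u (Suc (max n m))"
        by (rule u(5)[OF G_mono[OF m] G_mono[OF n]]) auto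
      then have "e \<alpha> x \<prec> i"
        using i(1) ord.less_trans by blast
      moreover have "x \<prec> \<alpha>"
        using \<open>x \<prec> y\<close> y ord.less_trans unfolding N_def G_def by blast
      ultimately show "x \<in> N \<inter> seg y"
        unfolding N_def G_def using \<open>x \<prec> y\<close> by simp
    next
      fix x assume x: "x \<in> N \<inter> seg y"
      obtain n where n: "x \<in> G (u n) \<alpha>"
        using N_level x by blast
      obtain m where m: "y \<in> G (u m) \<alpha>"
        using N_level[OF y] by blast
      have "e y x \<prec> u (Suc (max n m))"
        by (rule u(4)[OF G_mono[OF n] G_mono[OF m]]) (use x in auto)
      then show "x \<in> G i y"
        unfolding G_def using i(1) ord.less_trans x by auto
    qed
    have rk_mono: "rk i x \<prec> rk i y" if "x \<in> N" "y \<in> N" "x \<prec> y" for x y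
      by (rule rk(1)) (use GN[OF that(2)] that in simp)
    define \<zeta> where "\<zeta> = least (\<lambda>z. \<forall>x\<in>N. rk i x \<prec> z)"
    have "rk i ` N \<subseteq> seg l"
      using rk_l[OF il] by auto
    then obtain z where z: "z \<in> seg l" "\<forall>x\<in>N. rk i x \<prec> z"
      using succ_seg_bounded[OF lt _ cle_image_le[OF N_small], of "rk i"] by auto
    have \<zeta>1: "rk i x \<prec> \<zeta>" if "x \<in> N" for x
      unfolding \<zeta>_def using leastI[of "\<lambda>z. \<forall>x\<in>N. rk i x \<prec> z", OF z(2)] that by blast
    have "\<zeta> \<preceq> z"
      unfolding \<zeta>_def by (rule least_le) (rule z(2))
    then have \<zeta>l: "\<zeta> \<prec> l"
      using z(1) ord.le_less_trans by simp
    have \<zeta>2: "\<exists>x\<in>N. y \<preceq> rk i x" if "y \<prec> \<zeta>" for y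
      using not_less_least[OF that[unfolded \<zeta>_def]] by (auto simp: ord.not_less)
    \<comment> \<open>This sequence depends on \<xi> and cannot serve as a parameter. It only shows
      that \<zeta> admits a cofinal sequence of length \<theta>, so that the preassigned
      \<open>v \<zeta>\<close> is one.\<close>
    have "cofmap \<zeta> (\<lambda>k. rk i (\<xi> k))"
      unfolding cofmap_def
    proof (intro conjI allI impI)
      show "rk i (\<xi> k) \<prec> rk i (\<xi> j)" if "k \<prec> j \<and> j \<prec> t" for k j
        using rk_mono \<xi>N \<xi>(2) that ord.less_trans by blast
      show "rk i (\<xi> k) \<prec> \<zeta>" if "k \<prec> t" for k
        using \<zeta>1 \<xi>N that by blast
      fix y assume "y \<prec> \<zeta>"
      then obtain x where x: "x \<in> N" "y \<preceq> rk i x"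
        using \<zeta>2 by blast
      then have "x \<prec> \<alpha>"
        unfolding N_def G_def by blast
      then obtain k where k: "k \<prec> t" "x \<prec> \<xi> k"
        using cof by blast
      then have "y \<prec> rk i (\<xi> k)"
        using rk_mono[OF x(1) \<xi>N] x(2) ord.le_less_trans by blast
      then show "\<exists>k. k \<prec> t \<and> y \<prec> rk i (\<xi> k)"
        using k(1) by blast
    qed
    then have "cofmap \<zeta> (v \<zeta>)"
      unfolding v_def by (rule someI[of "cofmap \<zeta>"])
    then have v: "\<And>k j. k \<prec> j \<Longrightarrow> j \<prec> t \<Longrightarrow> v \<zeta> k \<prec> v \<zeta> j" "\<And>k. k \<prec> t \<Longrightarrow> v \<zeta> k \<prec> \<zeta>"
        "\<And>y. y \<prec> \<zeta> \<Longrightarrow> \<exists>k. k \<prec> t \<and> y \<prec> v \<zeta> k"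
      unfolding cofmap_def by blast+
    define A where "A = {x\<in>N. \<exists>k. k \<prec> t \<and> v \<zeta> k \<preceq> rk i x \<and> (\<forall>z\<in>G i x. rk i z \<prec> v \<zeta> k)}"
    have AN: "A \<subseteq> N"
      unfolding A_def by blast
    have A\<alpha>: "A \<subseteq> seg \<alpha>"
      unfolding A_def N_def G_def by auto
    \<comment> \<open>The chosen indices turn out to increase along \<open>A\<close>: if x < y in
      \<open>A\<close>, the rank of x reaches \<open>v \<zeta> (h x)\<close> and is below
      \<open>v \<zeta> (h y)\<close>. Hence initial segments of \<open>A\<close> have fewer than
      \<theta> elements.\<close>
    have "\<forall>x. \<exists>k. x \<in> A \<longrightarrow> k \<prec> t \<and> v \<zeta> k \<preceq> rk i x \<and> (\<forall>z\<in>G i x. rk i z \<prec> v \<zeta> k)"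
      unfolding A_def by blast
    from choice[OF this] obtain h where h: "\<And>x. x \<in> A \<Longrightarrow> h x \<prec> t" "\<And>x. x \<in> A \<Longrightarrow> v \<zeta> (h x) \<preceq> rk i x"
        "\<And>x z. x \<in> A \<Longrightarrow> z \<in> G i x \<Longrightarrow> rk i z \<prec> v \<zeta> (h x)"
      by blast
    have h_mono: "h x \<prec> h y" if "x \<in> A" "y \<in> A" "x \<prec> y" for x y
    proof (rule ccontr)
      assume "\<not> ?thesis"
      then have "h y = h x \<or> h y \<prec> h x"
        by (auto simp: ord.not_less ord.le_less)
      then have "v \<zeta> (h y) \<preceq> v \<zeta> (h x)"
        using v(1)[OF _ h(1)[OF that(1)]] ord.less_imp_le by auto
      also have "v \<zeta> (h x) \<preceq> rk i x"
        by (rule h(2)[OF that(1)])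
      also have "rk i x \<prec> v \<zeta> (h y)"
        by (rule h(3)[OF that(2)]) (simp add: GN[OF subsetD[OF AN that(2)]] subsetD[OF AN that(1)] that(3))
      finally show False
        by simp
    qed
    have inj_h: "inj_on h A"
      by (rule inj_onI) (metis h_mono ord.less_irrefl ord.linorder_cases)
    have A_cof: "\<exists>x\<in>A. y \<prec> x" if "y \<prec> \<alpha>" for y
    proof -
      obtain k where k: "k \<prec> t" "y \<prec> \<xi> k"
        using cof \<open>y \<prec> \<alpha>\<close> by blast
      obtain j where j: "j \<prec> t" "rk i (\<xi> k) \<prec> v \<zeta> j"
        using v(3)[OF \<zeta>1[OF \<xi>N[OF k(1)]]] by blast
      obtain x0 where x0: "x0 \<in> N \<and> v \<zeta> j \<preceq> rk i x0"
        using \<zeta>2[OF v(2)[OF j(1)]] by blast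
      \<comment> \<open>The first element of \<open>N\<close> whose rank reaches
        \<open>v \<zeta> j\<close> belongs to \<open>A\<close>, and it lies above
        \<open>\<xi> k\<close>, whose rank is still below that term.\<close>
      define x where "x = least (\<lambda>x. x \<in> N \<and> v \<zeta> j \<preceq> rk i x)"
      have x: "x \<in> N" "v \<zeta> j \<preceq> rk i x"
        unfolding x_def using leastI[of "\<lambda>x. x \<in> N \<and> v \<zeta> j \<preceq> rk i x", OF x0] by blast+
      have "rk i z \<prec> v \<zeta> j" if "z \<in> G i x" for z
        using not_less_least[of z "\<lambda>x. x \<in> N \<and> v \<zeta> j \<preceq> rk i x"] that GN[OF x(1)]
        unfolding x_def by (auto simp: ord.not_le)
      then have "x \<in> A"
        unfolding A_def using x j(1) by blast
      moreover have "\<xi> k \<prec> x"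
      proof (rule ccontr)
        assume "\<not> ?thesis"
        then have "x = \<xi> k \<or> x \<prec> \<xi> k"
          by (auto simp: ord.not_less ord.le_less)
        then have "rk i x \<preceq> rk i (\<xi> k)"
          using rk_mono[OF x(1) \<xi>N[OF k(1)]] ord.less_imp_le by auto
        then show False
          using x(2) j(2) by (metis ord.leD ord.less_le_trans)
      qed
      ultimately show ?thesis
        using k(2) ord.less_trans by blast
    qed
    have thin: "thin t \<alpha> A"
      unfolding thin_def ceq_iff
    proof (intro conjI allI impI)
      show "A \<subseteq> seg \<alpha>" by (rule A\<alpha>)
      show "cle A (seg t)"
        by (rule cleI[OF inj_h]) (use h(1) in simp)
      have "cofinal_in R A \<alpha>"
        by (rule cofinalI) (use A\<alpha> A_cof ord.less_imp_le in \<open>auto, blast\<close>)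
      then show "cle (seg t) A"
        using cf unfolding cf_is_def by blast
      fix y assume "y \<prec> \<alpha>"
      then obtain x where x: "x \<in> A" "y \<prec> x"
        using A_cof by blast
      have "cle (A \<inter> seg y) (seg (h x))"
        by (rule cleI[OF inj_on_subset[OF inj_h]]) (use h_mono x ord.less_trans in auto)
      then show "\<not> cle (seg t) (A \<inter> seg y)"
        using cardinal_less[OF t_card h(1)[OF x(1)]] cle_trans by blast
    qed
    have "\<exists>\<beta>. \<beta> \<prec> \<alpha> \<and> A \<inter> seg \<gamma> = a \<beta>" if \<gamma>: "\<gamma> \<prec> \<alpha>" for \<gamma>
    proof -
      \<comment> \<open>The cut at \<gamma> is moved up to the next element of \<open>N\<close>,
        because only there is the initial segment of \<open>N\<close> recovered from
        \<open>G\<close>.\<close>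
      define \<beta> where "\<beta> = least (\<lambda>\<beta>. \<beta> \<in> N \<and> \<gamma> \<preceq> \<beta>)"
      obtain k where "k \<prec> t" "\<gamma> \<prec> \<xi> k"
        using cof[OF \<gamma>] by blast
      then have "\<xi> k \<in> N \<and> \<gamma> \<preceq> \<xi> k"
        using \<xi>N ord.less_imp_le by blast
      then have \<beta>: "\<beta> \<in> N" "\<gamma> \<preceq> \<beta>"
        unfolding \<beta>_def using leastI[of "\<lambda>\<beta>. \<beta> \<in> N \<and> \<gamma> \<preceq> \<beta>" "\<xi> k"] by blast+
      have min: "x \<prec> \<gamma>" if "x \<in> N" "x \<prec> \<beta>" for x
        using not_less_least[of x "\<lambda>\<beta>. \<beta> \<in> N \<and> \<gamma> \<preceq> \<beta>"] that unfolding \<beta>_def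
        by (auto simp: ord.not_le)
      have "A \<inter> seg \<gamma> = A \<inter> seg \<beta>"
        using min AN ord.less_le_trans[OF _ \<beta>(2)] by auto
      also have "\<dots> = Q \<beta> i \<zeta>"
        unfolding A_def Q_def GN[OF \<beta>(1)] by blast
      finally have eq: "A \<inter> seg \<gamma> = Q \<beta> i \<zeta>" .
      obtain b where b: "\<pi> b = (\<beta>, i, \<zeta>)"
        using \<pi> by (metis surjD)
      have "a b = Q \<beta> i \<zeta>"
        unfolding a_def b by simp
      then have 1: "a (idx (Q \<beta> i \<zeta>)) = Q \<beta> i \<zeta>"
        unfolding idx_def by (rule leastI)
      have "\<beta> \<prec> \<alpha>"
        using \<beta>(1) unfolding N_def G_def by blast
      then obtain k where k: "k \<prec> t" "\<beta> \<prec> \<xi> k"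
        using cof by blast
      have "(\<beta>, i, \<zeta>) \<in> insert (\<xi> k) (seg (\<xi> k)) \<times> seg l \<times> seg l"
        using k(2) il \<zeta>l by simp
      then have "idx (Q \<beta> i \<zeta>) \<in> \<Psi> \<xi> k"
        unfolding \<Psi>_def by (rule rev_image_eqI) simp
      then have "idx (Q \<beta> i \<zeta>) \<prec> \<alpha>"
        unfolding \<alpha>_def by (rule \<xi>(3)[OF k(1)])
      then show ?thesis
        using 1 eq by metis
    qed
    then have "\<alpha> \<in> approachable a"
      unfolding approachable_def using thin by blast
    then show ?thesis
      using \<xi>(1) unfolding \<alpha>_def by blast
  qed
  then show ?thesis
    unfolding stationary_def using a_bd by blast
qed

lemma succ_seg_least:
  assumes "infinite (seg p)" "\<not> cle (seg x) (seg p)"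
  defines "s \<equiv> least (\<lambda>x. \<not> cle (seg x) (seg p))"
  shows "succ_seg (seg s) p" "s \<preceq> x" "p \<prec> s"
proof -
  have s: "\<not> cle (seg s) (seg p)"
    unfolding s_def by (rule leastI[of _ x]) (rule assms)
  have "cle (seg y) (seg p)" if "y \<prec> s" for y
    using not_less_least[OF that[unfolded s_def]] by blast
  then show "succ_seg (seg s) p"
    unfolding succ_seg_def using assms(1) s seg_mono ord.less_imp_le by simp
  show "s \<preceq> x"
    unfolding s_def by (rule least_le) (rule assms)
  show "p \<prec> s"
    using s cle_subset[OF seg_mono[of s p]] by (auto simp: ord.not_le[symmetric])
qed

lemma stationary_approachable:
  "\<exists>S. S \<in> I_ideal R \<and> stationary R S \<and> S \<subseteq> E_cof R t"
proof -
  define s where "s = least (\<lambda>x. \<not> cle (seg x) (seg t))"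
  have s: "succ_seg (seg s) t" "s \<preceq> l" "t \<prec> s"
    unfolding s_def by (rule succ_seg_least[OF t_inf t_small])+
  have "\<exists>a. (\<forall>\<beta>. \<exists>\<gamma>. a \<beta> \<subseteq> seg \<gamma>) \<and> stationary R (approachable a)"
  proof (cases "s = l")
    case True
    then show ?thesis
      using stationary_approachable_successor s(1) by simp
  next
    \<comment> \<open>Here \<open>l\<close> witnesses that \<theta>^{++} is an element of the
      type.\<close>
    case False
    then have "s \<prec> l"
      using s(2) by (simp add: ord.le_less)
    then have big: "\<not> cle (seg l) (seg s)"
      by (rule cardinal_less[OF l_card])
    have inf: "infinite (seg s)"
      using t_inf seg_mono[OF ord.less_imp_le[OF s(3)]] finite_subset by blast
    show ?thesis
      by (rule stationary_approachable_guess[OF s(1) succ_seg_least(1)[OF inf big]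
            ord.less_trans[OF s(3) succ_seg_least(3)[OF inf big]]])
  qed
  then show ?thesis
    using approachable_in_I approachable_sub by blast
qed

end

theorem theorem3p7:
  fixes R :: "'a rel" and l t c :: 'a
  assumes wo: "Well_order R" and fld: "Field R = UNIV"
    and l_card: "is_cardinal R l" and l_inf: "infinite (below R l)"
    and succ_bound: "\<forall>\<alpha>. cle (below R \<alpha>) (below R l)"
    and succ_big: "\<not> cle (UNIV :: 'a set) (below R l)"
    and t_inf: "infinite (below R t)" and t_reg: "cf_is R t t"
    and c_cases: "(finite (below R c) \<and> card (below R c) = 2) \<or>
                  (is_cardinal R c \<and> infinite (below R c))"
    and c_le_t: "(c, t) \<in> R" and t_lt_l: "olt R t l"
    and t_ne_cf: "\<not> cf_is R l t"
  shows "((\<forall>S. S \<in> I_ideal R \<and> S \<subseteq> E_cof R t \<longrightarrow> S \<in> J_ideal R c)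
          \<longleftrightarrow> (\<exists>S. S \<in> J_ideal R c \<and> stationary R S \<and> S \<subseteq> E_cof R t))
       \<and> ((\<exists>S. S \<in> J_ideal R c \<and> stationary R S \<and> S \<subseteq> E_cof R t)
          \<longleftrightarrow> m_is R (below R t) (below R l) t c (below R l))
       \<and> (m_is R (below R t) (below R l) t c (below R l)
          \<longleftrightarrow> m_is R (below R l) (below R l) t c (below R l))"
proof -
  have "below R c \<noteq> {}"
    using c_cases by auto
  then interpret succ_card R l t c
    using assms by unfold_locales auto
  show ?thesis
    using stationary_approachable J_stationary_imp_m_t m_t_imp_m_l m_l_imp_m_t m_l_imp_I_sub_J
    by blast
qed

end
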